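(* Let $q$ be an even power of an odd prime. The following hold: (i) For $q>9$, $\mathfrak{X}(\mathrm{M}(q),\mathcal{L}_+)$ is a non-symmetric association scheme with $(3q+5)/8$ classes. (ii) $\mathfrak{X}(\mathrm{M}(9),\mathcal{L}_+)$ is a symmetric $P$-polynomial association scheme.
   Context: Association schemes: if a group $G$ acts transitively on a finite set $X$, the orbits of the induced diagonal action of $G$ on $X\times X$ are the relations of an association scheme, denoted $\mathfrak{X}(G,X)$. One of these relations is the diagonal $R_0$; if there are $d$ other relations, the scheme is said to have $d$ classes. A relation $R$ is symmetric if $(x,y)\in R$ implies $(y,x)\in R$; the scheme is symmetric if all of its relations are symmetric, and non-symmetric otherwise. A symmetric scheme with $d$ classes is $P$-polynomial if its relations can be ordered $R_0,R_1,\dots,R_d$ (with $R_0$ the diagonal) so that the graph $(X,R_1)$ is distance-regular of diameter $d$ and $R_i$ is its distance-$i$ relation for every $i$. The group $\mathrm{M}(q)$: let $q=p^{2f}$ with $p$ an odd prime and $f$ a positive integer, and let $\sigma$ be the unique involution in $\mathrm{Aut}(\mathbb{F}_q)$. Then $\mathrm{M}(q)=S\cup T$ is the group of permutations of $\mathrm{PG}(1,q)=\mathbb{F}_q\cup\{\infty\}$, where $S=\{\lambda\mapsto \frac{a\lambda+b}{c\lambda+d} \mid a,b,c,d\in\mathbb{F}_q,\ ad-bc \text{ a square in } \mathbb{F}_q^*\}$ and $T=\{\lambda\mapsto \frac{a\lambda^\sigma+b}{c\lambda^\sigma+d}\mid a,b,c,d\in\mathbb{F}_q,\ ad-bc\text{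 a non-square in }\mathbb{F}_q^*\}$ (with the usual conventions for $\infty$). Hyperbolic lines and the action: in $\mathrm{PG}(2,q)$ let $P_\xi=(\xi^2:\xi:1)$ for $\xi\in\mathbb{F}_q$, $P_\infty=(1:0:0)$, and let $\mathscr{O}=\{P_\xi\mid \xi\in\mathbb{F}_q\cup\{\infty\}\}$, a conic. A line is hyperbolic if it meets $\mathscr{O}$ in exactly 2 points; $\mathcal{L}_+$ is the set of hyperbolic lines, i.e. the lines $L_{\xi,\gamma}$ through $P_\xi$ and $P_\gamma$ for distinct $\xi,\gamma\in\mathbb{F}_q\cup\{\infty\}$. The group $\mathrm{P}\Gamma\mathrm{L}(2,q)$, and hence its subgroup $\mathrm{M}(q)$, acts on $\mathrm{PG}(2,q)$ through the embedding $\rho$ into $\mathrm{P}\Gamma\mathrm{L}(3,q)$ sending the class of $\left(\begin{pmatrix} a&b\\c&d\end{pmatrix},\tau\right)$ to the class of the semilinear map $v\mapsto \begin{pmatrix} a^2&2ab&b^2\\ ac&ad+bc&bd\\ c^2&2cd&d^2\end{pmatrix}v^\tau$, where $v^\tau$ is obtained by applying $\tau\in\mathrm{Aut}(\mathbb{F}_q)$ to the coordinates. This action preserves $\mathscr{O}$, and $g$ maps $L_{\xi,\gamma}$ to $L_{g(\xi),g(\gamma)}$. Thus $\mathrm{M}(q)$ acts transitively on $\mathcal{L}_+$, equivalently to its action on the 2-element subsets of $\mathrm{PG}(1,q)$. *)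

theory Defs
  imports
    "HOL-Analysis.Analysis"
    "HOL-Algebra.Group_Action"
    "HOL-Library.Disjoint_Sets"
    "HOL-Computational_Algebra.Nth_Powers"
begin

section \<open>Association schemes\<close>

text \<open>
  Commutativity of the intersection numbers is not part of the definition: the orbits of any
  transitive group on ordered pairs are to form an association scheme.
\<close>

definition association_scheme :: "'x set \<Rightarrow> 'x rel set \<Rightarrow> bool" where
  "association_scheme X Rs \<longleftrightarrow>
     finite X \<and> X \<noteq> {} \<and> partition_on (X \<times> X) Rs \<and> Id_on X \<in> Rs \<and>
     (\<forall>R\<in>Rs. R\<inverse> \<in> Rs) \<and>
     (\<forall>R\<in>Rs. \<forall>S\<in>Rs. \<forall>T\<in>Rs. \<exists>n. \<forall>(x, y)\<in>T. card {z \<in> X. (x, z) \<in> R \<and> (z, y) \<in> S} = n)"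

definition num_classes :: "'x set \<Rightarrow> 'x rel set \<Rightarrow> nat" where
  "num_classes X Rs = card (Rs - {Id_on X})"

definition symmetric_scheme :: "'x rel set \<Rightarrow> bool" where
  "symmetric_scheme Rs \<longleftrightarrow> (\<forall>R\<in>Rs. sym R)"

definition orbital_scheme :: "('g, 'm) monoid_scheme \<Rightarrow> 'x set \<Rightarrow> ('g \<Rightarrow> 'x \<Rightarrow> 'x) \<Rightarrow> 'x rel set" where
  "orbital_scheme G X \<phi> = orbits G (X \<times> X) (\<lambda>g. map_prod (\<phi> g) (\<phi> g))"


section \<open>Distance-regular graphs and P-polynomial schemes\<close>

definition simple_graph :: "'x set \<Rightarrow> 'x rel \<Rightarrow> bool" where
  "simple_graph X E \<longleftrightarrow> finite X \<and> E \<subseteq> X \<times> X \<and> sym E \<and> irrefl E"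

definition connected_graph :: "'x set \<Rightarrow> 'x rel \<Rightarrow> bool" where
  "connected_graph X E \<longleftrightarrow> X \<noteq> {} \<and> (\<forall>x\<in>X. \<forall>y\<in>X. (x, y) \<in> E\<^sup>*)"

text \<open>The following three notions are only meaningful for connected graphs.\<close>

definition graph_dist :: "'x rel \<Rightarrow> 'x \<Rightarrow> 'x \<Rightarrow> nat" where
  "graph_dist E x y = (LEAST n. (x, y) \<in> E ^^ n)"

definition graph_diameter :: "'x set \<Rightarrow> 'x rel \<Rightarrow> nat" where
  "graph_diameter X E = Max {graph_dist E x y | x y. x \<in> X \<and> y \<in> X}"

definition distance_rel :: "'x set \<Rightarrow> 'x rel \<Rightarrow> nat \<Rightarrow> 'x rel" where
  "distance_rel X E i = {(x, y) \<in> X \<times> X. graph_dist E x y = i}"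

definition distance_regular :: "'x set \<Rightarrow> 'x rel \<Rightarrow> bool" where
  "distance_regular X E \<longleftrightarrow>
     simple_graph X E \<and> connected_graph X E \<and>
     (\<forall>i. \<exists>b c. \<forall>(x, y) \<in> distance_rel X E i.
        card {z \<in> X. (y, z) \<in> E \<and> graph_dist E x z = i + 1} = b \<and>
        card {z \<in> X. (y, z) \<in> E \<and> graph_dist E x z + 1 = i} = c)"

definition P_polynomial_scheme :: "'x set \<Rightarrow> 'x rel set \<Rightarrow> bool" where
  "P_polynomial_scheme X Rs \<longleftrightarrow>
     association_scheme X Rs \<and> symmetric_scheme Rs \<and>
     (\<exists>R :: nat \<Rightarrow> 'x rel.
        bij_betw R {0..num_classes X Rs} Rs \<and> R 0 = Id_on X \<and>
        distance_regular X (R 1) \<and> graph_diameter X (R 1) = num_classes X Rs \<and>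
        (\<forall>i\<le>num_classes X Rs. R i = distance_rel X (R 1) i))"


section \<open>The group M(q)\<close>

text \<open>
  The field with \<open>q\<close> elements is a finite field type \<open>'a\<close>, and
  \<open>PG(1,q)\<close> is \<open>'a option\<close> with \<open>None\<close> in the role of infinity.
\<close>

definition field_aut :: "('a::field \<Rightarrow> 'a) \<Rightarrow> bool" where
  "field_aut \<tau> \<longleftrightarrow> bij \<tau> \<and> (\<forall>x y. \<tau> (x + y) = \<tau> x + \<tau> y) \<and> (\<forall>x y. \<tau> (x * y) = \<tau> x * \<tau> y)"

text \<open>Well-defined when \<open>CARD('a)\<close> is an even power of a prime.\<close>

definition aut_involution :: "'a::{field,finite} \<Rightarrow> 'a" where
  "aut_involution = (THE \<sigma>. field_aut \<sigma> \<and> \<sigma> \<noteq> id \<and> \<sigma> \<circ> \<sigma> = id)"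

definition semilin_frac :: "'a::field^2^2 \<Rightarrow> ('a \<Rightarrow> 'a) \<Rightarrow> 'a option \<Rightarrow> 'a option" where
  "semilin_frac A \<tau> \<xi> =
     (case \<xi> of
        None \<Rightarrow> if A$2$1 = 0 then None else Some (A$1$1 / A$2$1)
      | Some x \<Rightarrow> if A$2$1 * \<tau> x + A$2$2 = 0 then None
                  else Some ((A$1$1 * \<tau> x + A$1$2) / (A$2$1 * \<tau> x + A$2$2)))"

definition M_perms :: "('a::{field,finite} option \<Rightarrow> 'a option) set" where
  "M_perms =
     {semilin_frac A id | A. det A \<noteq> 0 \<and> is_square (det A)} \<union>
     {semilin_frac A aut_involution | A. det A \<noteq> 0 \<and> \<not> is_square (det A)}"

definition M_group :: "('a::{field,finite} option \<Rightarrow> 'a option) monoid" where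
  "M_group = (BijGroup UNIV)\<lparr>carrier := M_perms\<rparr>"


section \<open>Hyperbolic lines\<close>

text \<open>
  Points and lines of \<open>PG(2,q)\<close> are the subspaces of \<open>'a^3\<close> of dimension 1 and 2,
  incidence being inclusion.
\<close>

definition conic_point :: "'a::field option \<Rightarrow> ('a^3) set" where
  "conic_point \<xi> = vec.span {case \<xi> of None \<Rightarrow> vector [1, 0, 0] | Some x \<Rightarrow> vector [x^2, x, 1]}"

definition conic :: "('a::field^3) set set" where
  "conic = range conic_point"

definition hyperbolic_lines :: "('a::field^3) set set" where
  "hyperbolic_lines =
     {L. vec.subspace L \<and> vec.dim L = 2 \<and> card {P \<in> conic. P \<subseteq> L} = 2}"

definition sym_square :: "'a::field^2^2 \<Rightarrow> 'a^3^3" where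
  "sym_square A =
     (let a = A$1$1; b = A$1$2; c = A$2$1; d = A$2$2 in
      vector [vector [a^2,   2 * a * b,     b^2],
              vector [a * c, a * d + b * c, b * d],
              vector [c^2,   2 * c * d,     d^2]])"

definition plane_map :: "'a::field^2^2 \<Rightarrow> ('a \<Rightarrow> 'a) \<Rightarrow> 'a^3 \<Rightarrow> 'a^3" where
  "plane_map A \<tau> v = sym_square A *v (\<chi> i. \<tau> (v $ i))"

text \<open>
  The action through the embedding \<open>\<rho>\<close> of an element of the projective semilinear group,
  given as a permutation of \<open>PG(1,q)\<close>, on the subspaces of \<open>'a^3\<close>. The lemma
  \<open>plane_action_semilin_frac\<close> shows that it does not depend on the semilinear representative.
\<close>

definition plane_action :: "('a::field option \<Rightarrow> 'a option) \<Rightarrow> ('a^3) set \<Rightarrow> ('a^3) set" where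
  "plane_action g U =
     (THE V. \<exists>A \<tau>. det A \<noteq> 0 \<and> field_aut \<tau> \<and> g = semilin_frac A \<tau> \<and> V = plane_map A \<tau> ` U)"

lemma field_aut_0: "field_aut \<tau> \<Longrightarrow> \<tau> 0 = 0"
  unfolding field_aut_def by (metis add_cancel_left_left)

lemma field_aut_1:
  assumes "field_aut \<tau>" shows "\<tau> 1 = 1"
proof -
  have "\<tau> 1 \<noteq> 0"
    using assms field_aut_0[OF assms] unfolding field_aut_def by (metis bij_pointE zero_neq_one)
  moreover have "\<tau> 1 * \<tau> 1 = \<tau> 1"
    using assms unfolding field_aut_def by (metis mult_1)
  ultimately show ?thesis by simp
qed

lemma semilin_frac_eqD:
  fixes A B :: "'a::field^2^2"
  assumes A: "det A \<noteq> 0" and B: "det B \<noteq> 0"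
    and \<tau>: "field_aut \<tau>" and \<upsilon>: "field_aut \<upsilon>"
    and eq: "semilin_frac A \<tau> = semilin_frac B \<upsilon>"
  shows "\<tau> = \<upsilon> \<and> (\<exists>s. s \<noteq> 0 \<and> (\<forall>i j. B$i$j = s * A$i$j))"
proof -
  define a b c d where A_def: "a = A$1$1" "b = A$1$2" "c = A$2$1" "d = A$2$2"
  define a' b' c' d' where B_def: "a' = B$1$1" "b' = B$1$2" "c' = B$2$1" "d' = B$2$2"
  have dA: "a * d - b * c \<noteq> 0" using A by (simp add: det_2 A_def)
  have dB: "a' * d' - b' * c' \<noteq> 0" using B by (simp add: det_2 B_def)
  have inf: "a * c' = c * a'"
  proof -
    from fun_cong[OF eq, of None] have
      "(if c = 0 then None else Some (a / c)) = (if c' = 0 then None else Some (a' / c'))"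
      unfolding A_def B_def by (simp add: semilin_frac_def split del: if_split)
    then show ?thesis by (auto split: if_splits simp: field_simps)
  qed
  have fin: "(a * \<tau> x + b) * (c' * \<upsilon> x + d') = (c * \<tau> x + d) * (a' * \<upsilon> x + b')" for x
  proof -
    from fun_cong[OF eq, of "Some x"] have
      "(if c * \<tau> x + d = 0 then None else Some ((a * \<tau> x + b) / (c * \<tau> x + d))) =
       (if c' * \<upsilon> x + d' = 0 then None else Some ((a' * \<upsilon> x + b') / (c' * \<upsilon> x + d')))"
      unfolding A_def B_def by (simp add: semilin_frac_def split del: if_split)
    then show ?thesis
      by (cases "c * \<tau> x + d = 0"; cases "c' * \<upsilon> x + d' = 0")
         (simp_all add: frac_eq_eq mult.commute)
  qed
  have zero: "b * d' = d * b'"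
    using fin[of 0] by (simp add: field_aut_0[OF \<tau>] field_aut_0[OF \<upsilon>])
  have one: "(a + b) * (c' + d') = (c + d) * (a' + b')"
    using fin[of 1] by (simp add: field_aut_1[OF \<tau>] field_aut_1[OF \<upsilon>])
  have proportional: "\<exists>s. s \<noteq> 0 \<and> x' = s * x \<and> y' = s * y"
    if "x * y' = y * x'" "x \<noteq> 0 \<or> y \<noteq> 0" "x' \<noteq> 0 \<or> y' \<noteq> 0" for x y x' y' :: 'a
  proof (cases "x = 0")
    case True
    then show ?thesis using that by (intro exI[of _ "y' / y"]) auto
  next
    case False
    then have "y' = x' / x * y" "x' / x \<noteq> 0" using that by (auto simp: field_simps)
    then show ?thesis using False by (intro exI[of _ "x' / x"]) auto
  qed
  have nz: "a \<noteq> 0 \<or> c \<noteq> 0" "b \<noteq> 0 \<or> d \<noteq> 0" "a' \<noteq> 0 \<or> c' \<noteq> 0" "b' \<noteq> 0 \<or> d' \<noteq> 0"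
    using dA dB by auto
  obtain s where s: "s \<noteq> 0" "a' = s * a" "c' = s * c"
    using proportional[OF inf] nz by blast
  obtain t where t: "t \<noteq> 0" "b' = t * b" "d' = t * d"
    using proportional[OF zero] nz by blast
  have "(t - s) * (a * d - b * c) = 0"
    using one unfolding s t by (simp add: algebra_simps)
  then have ts: "t = s" using dA by simp
  have "\<tau> x = \<upsilon> x" for x
  proof -
    have "s * ((a * d - b * c) * (\<tau> x - \<upsilon> x)) = 0"
      using fin[of x] unfolding s t ts by (simp add: algebra_simps)
    then show ?thesis using s dA by simp
  qed
  moreover have "\<forall>i j. B$i$j = s * A$i$j"
    using s t ts by (simp add: forall_2 A_def B_def)
  ultimately show ?thesis using s by auto
qed

lemma plane_action_semilin_frac:
  fixes A :: "'a::field^2^2"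
  assumes A: "det A \<noteq> 0" and \<tau>: "field_aut \<tau>" and U: "vec.subspace U"
  shows "plane_action (semilin_frac A \<tau>) U = plane_map A \<tau> ` U"
proof -
  have "plane_map B \<upsilon> ` U = plane_map A \<tau> ` U"
    if B: "det B \<noteq> 0" "field_aut \<upsilon>" "semilin_frac A \<tau> = semilin_frac B \<upsilon>" for B \<upsilon>
  proof -
    from semilin_frac_eqD[OF A B(1) \<tau> B(2,3)] obtain s
      where s: "s \<noteq> 0" "\<And>i j. B$i$j = s * A$i$j" and \<upsilon>: "\<upsilon> = \<tau>" by auto
    obtain r where r: "\<tau> r = s" using \<tau> unfolding field_aut_def by (metis bij_pointE)
    have r0: "r \<noteq> 0" using r s field_aut_0[OF \<tau>] by auto
    have mult: "\<tau> (x * y) = \<tau> x * \<tau> y" for x y using \<tau> by (simp add: field_aut_def)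
    have "plane_map B \<tau> v = plane_map A \<tau> ((r^2) *s v)" for v
    proof -
      have "sym_square B $ i $ j = s\<^sup>2 * sym_square A $ i $ j" for i j
        by (rule spec[where x = j], rule spec[where x = i])
           (simp add: forall_3 sym_square_def Let_def s power2_eq_square algebra_simps)
      moreover have "\<tau> (r\<^sup>2 * x) = s\<^sup>2 * \<tau> x" for x
        by (simp add: power2_eq_square mult r)
      ultimately show ?thesis
        by (simp add: plane_map_def vec_eq_iff matrix_vector_mult_def ac_simps)
    qed
    then have "plane_map B \<tau> ` U = plane_map A \<tau> ` ((\<lambda>v. (r^2) *s v) ` U)"
      by (simp add: image_image)
    also have "(\<lambda>v. (r^2) *s v) ` U = U"
    proof
      show "(\<lambda>v. (r^2) *s v) ` U \<subseteq> U" using U by (auto simp: vec.subspace_scale)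
      show "U \<subseteq> (\<lambda>v. (r^2) *s v) ` U"
      proof
        fix v assume "v \<in> U"
        then have "(inverse (r^2)) *s v \<in> U" using U by (simp add: vec.subspace_scale)
        moreover have "v = (r^2) *s ((inverse (r^2)) *s v)"
          using r0 by (simp add: vector_smult_assoc)
        ultimately show "v \<in> (\<lambda>v. (r^2) *s v) ` U" by blast
      qed
    qed
    finally show ?thesis using \<upsilon> by simp
  qed
  then show ?thesis
    unfolding plane_action_def using A \<tau> by (intro the_equality) blast+
qed

definition M_scheme :: "(('a::{field,finite}^3) set) rel set" where
  "M_scheme = orbital_scheme M_group hyperbolic_lines plane_action"

end

theory Submission
  imports Defs "HOL-Number_Theory.Residues"
begin

text \<open>
  Write \<open>q = r\<^sup>2\<close>. Everything is transported from hyperbolic lines to the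
  2-subsets of \<open>PG(1,q)\<close>: a line of \<open>PG(2,q)\<close> meets the conic in at
  most two points, so the hyperbolic lines are the chords (\<open>bij_betw_chord\<close>), and
  the embedding of the semilinear group sends the chord over \<open>s\<close> to the chord
  over \<open>g ` s\<close> (\<open>plane_action_chord\<close>). That \<open>M(q)\<close> is
  closed under composition and inverses is a computation in homogeneous coordinates; it relies
  on the fact that the quadratic character of the determinant is multiplicative and invariant
  under \<open>\<sigma>\<close>, so that it decides consistently whether a transformation is
  twisted by \<open>\<sigma>\<close>. The orbits of a transitive group on pairs always form an
  association scheme (\<open>association_scheme_orbital\<close>).

  The classes are then counted with 3-transitivity. Two distinct 2-subsets which meet can be
  moved to \<open>{\<infinity>, 0}\<close> and \<open>{\<infinity>, 1}\<close>, which gives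
  one class. Disjoint 2-subsets can be moved to \<open>{\<infinity>, 0}\<close> and
  \<open>{1, k}\<close>. The stabilizer of \<open>{\<infinity>, 0}\<close> consists of the
  maps \<open>x \<mapsto> m x\<close>, \<open>x \<mapsto> m / x\<close> with
  \<open>m\<close> a square and \<open>x \<mapsto> m \<sigma> x\<close>,
  \<open>x \<mapsto> m / \<sigma> x\<close> with \<open>m\<close> a nonsquare; hence
  \<open>k\<close> is determined up to inversion if it is a square, and up to inversion and
  \<open>\<sigma>\<close> if it is a nonsquare (\<open>ratio_orbital_eq_iff\<close>).
  Nonsquares \<open>k\<close> fall into groups of exactly 4, since both
  \<open>\<sigma> k = k\<close> and \<open>k \<sigma> k = 1\<close> force
  \<open>k\<close> to be a square by Euler's criterion; squares other than \<open>0\<close>,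
  \<open>1\<close>, \<open>-1\<close> fall into pairs, and \<open>k = -1\<close> stands
  alone. The total is
  \<open>1 + (q - 1) / 8 + (q - 5) / 4 + 1 = (3 q + 5) / 8\<close>
  (\<open>num_classes_M_scheme\<close>).

  Interchanging the two 2-subsets replaces \<open>k\<close> by \<open>k\<close> if
  \<open>k - 1\<close> is a square and by \<open>\<sigma> k\<close> otherwise
  (\<open>ratio_orbital_converse\<close>). So the scheme is non-symmetric as soon as there is
  a square \<open>k\<close> for which \<open>k - 1\<close> is a nonsquare and
  \<open>\<sigma> k\<close> is neither \<open>k\<close> nor \<open>1 / k\<close>. For a
  nonsquare \<open>m\<close>, the element
  \<open>k = ((1 + m) / (1 - m))\<^sup>2\<close> satisfies the first two conditions,
  and the last one excludes fewer values of \<open>m\<close> than there are nonsquares once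
  \<open>r \<ge> 5\<close> (\<open>exists_nonsymmetric_ratio\<close>).

  For \<open>q = 9\<close> there are four classes. With
  \<open>\<iota>\<^sup>2 = -1\<close>, the distances \<open>1\<close>, \<open>2\<close>,
  \<open>3\<close>, \<open>4\<close> are given by \<open>k = -1\<close> (harmonic pairs),
  \<open>k = \<iota>\<close>, 2-subsets with one common point, and \<open>k\<close> a
  nonsquare. To verify this it suffices to exhibit a path for each distance, and to see that a
  step along \<open>k = -1\<close> raises the index by at most one
  (\<open>P_polynomial_schemeI\<close>); the latter follows from the quadratic character of
  the cross ratio (\<open>orbital_square_cross_ratio\<close>).
\<close>

section \<open>Finite fields of square order\<close>

text \<open>
  Lagrange's theorem in the form used for the whole field and for a fixed field:
  multiplication by \<open>x\<close> permutes \<open>S\<close>, so the product of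
  \<open>S\<close> is multiplied by \<open>x ^ card S\<close> and yet unchanged.
\<close>
lemma power_card_mult_closed:
  fixes x :: "'a::field"
  assumes "finite S" "0 \<notin> S" "x \<in> S" and closed: "\<And>y z. y \<in> S \<Longrightarrow> z \<in> S \<Longrightarrow> y * z \<in> S"
  shows "x ^ card S = 1"
proof -
  have x0: "x \<noteq> 0" using assms(2,3) by blast
  have inj: "inj_on ((*) x) S" using x0 by (simp add: inj_on_def)
  have "(*) x ` S = S"
    using assms inj by (intro card_subset_eq) (auto simp: card_image)
  then have "\<Prod>S = (\<Prod>y\<in>S. x * y)"
    using prod.reindex[OF inj, of id] by simp
  also have "\<dots> = x ^ card S * \<Prod>S"
    by (simp add: prod.distrib)
  finally show ?thesis using assms(1,2) by (simp add: prod_zero_iff)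
qed

lemma card_power_eq_le:
  fixes c :: "'a::idom"
  assumes "n > 0" shows "card {x. x ^ n = c} \<le> n" and "finite {x. x ^ n = c}"
proof -
  let ?P = "Polynomial.monom 1 n - [:c:]"
  have "Polynomial.coeff ?P n = 1" using assms by (cases n) auto
  then have "?P \<noteq> 0" by (metis coeff_0 zero_neq_one)
  moreover have "degree ?P \<le> n" 
    by (intro degree_diff_le) (auto simp: degree_monom_le)
  moreover have "{x. poly ?P x = 0} = {x. x ^ n = c}" by (auto simp: poly_monom)
  ultimately show "card {x. x ^ n = c} \<le> n" "finite {x. x ^ n = c}"
    using card_poly_roots_bound[of ?P] poly_roots_finite[of ?P] by auto
qed

lemma card_image_fibres:
  assumes "finite A" "\<And>a. a \<in> A \<Longrightarrow> card {x \<in> A. f x = f a} = n"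
  shows "n * card (f ` A) = card A"
proof -
  have "card A = (\<Sum>y\<in>f ` A. card {x \<in> A. f x = y})"
    using sum.image_gen[OF assms(1), of "\<lambda>_. 1::nat" f] by simp
  also have "\<dots> = (\<Sum>y\<in>f ` A. n)"
    by (rule sum.cong) (auto simp: assms(2))
  finally show ?thesis by simp
qed

text \<open>
  The field has \<open>q = r\<^sup>2\<close> elements and \<open>\<sigma>\<close> is the
  \<open>r\<close>-th power map. Its additivity encodes that \<open>r\<close> is a power of
  the characteristic.
\<close>
locale square_order_field =
  fixes r :: nat and \<sigma> :: "'a::{field,finite} \<Rightarrow> 'a"
  assumes card_field: "CARD('a) = r\<^sup>2" and odd_r: "odd r"
    and \<sigma>_power: "\<sigma> x = x ^ r" and \<sigma>_add: "\<sigma> (x + y) = \<sigma> x + \<sigma> y"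
begin

lemma r_ge_3: "r \<ge> 3"
proof -
  have "card {0, 1::'a} \<le> CARD('a)" by (intro card_mono) auto
  then have "r \<noteq> 1" by (auto simp: card_field)
  with odd_r show ?thesis by (auto elim!: oddE)
qed

lemma two_neq_0: "(2::'a) \<noteq> 0"
proof
  assume "(2::'a) = 0"
  then have "of_nat 2 = (0::'a)" by simp
  then have "CHAR('a) dvd 2" by (simp only: of_nat_eq_0_iff_char_dvd)
  then have "CHAR('a) = 2" using CHAR_not_1' by (metis One_nat_def prime_nat_iff two_is_prime_nat)
  then show False using CHAR_dvd_CARD[where ?'a='a] odd_r by (simp add: card_field)
qed

lemma minus_neq_self: "x \<noteq> 0 \<Longrightarrow> - x \<noteq> (x::'a)"
  using two_neq_0 by (metis mult_2 mult_eq_0_iff neg_eq_iff_add_eq_0)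

lemma minus_one_neq_one: "(-1::'a) \<noteq> 1" "(1::'a) \<noteq> -1"
  using minus_neq_self[of 1] by auto

definition half_order :: nat where "half_order = (r\<^sup>2 - 1) div 2"

lemma eight_dvd: "8 dvd r\<^sup>2 - 1"
proof -
  obtain k where k: "r = 2 * k + 1" using odd_r by (auto elim: oddE)
  have "r\<^sup>2 - 1 = 4 * (k * (k + 1))" by (simp add: k power2_eq_square algebra_simps)
  moreover obtain j where "k * (k + 1) = 2 * j" using evenE[of "k * (k + 1)"] by auto
  ultimately have "r\<^sup>2 - 1 = 8 * j" by simp
  then show ?thesis by simp
qed

lemma half_order_facts: "2 * half_order = r\<^sup>2 - 1" "even half_order" "half_order > 0" "half_order = (r - 1) div 2 * (r + 1)" "half_order = (r - 1) * ((r + 1) div 2)"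
proof -
  obtain m where m: "r\<^sup>2 - 1 = 8 * m" using eight_dvd by (auto elim: dvdE)
  show "2 * half_order = r\<^sup>2 - 1" "even half_order" unfolding half_order_def m by auto
  obtain k where k: "r = 2 * k + 1" using odd_r by (auto elim: oddE)
  have e: "r\<^sup>2 - 1 = 4 * (k * (k + 1))" by (simp add: k power2_eq_square algebra_simps)
  have "k > 0" using r_ge_3 k by simp
  moreover have "half_order = 2 * (k * (k + 1))" unfolding half_order_def e by simp
  ultimately show "half_order > 0" "half_order = (r - 1) div 2 * (r + 1)" "half_order = (r - 1) * ((r + 1) div 2)"
    by (simp_all add: k)
qed

lemma power_card_minus_1: "x \<noteq> 0 \<Longrightarrow> x ^ (r\<^sup>2 - 1) = (1::'a)"
  using power_card_mult_closed[of "UNIV - {0::'a}" x] by (simp add: card_Diff_singleton card_field)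

lemma power_half_order: "x \<noteq> 0 \<Longrightarrow> x ^ half_order = 1 \<or> x ^ half_order = (-1::'a)"
  using power_card_minus_1[of x] half_order_facts(1) 
  by (metis mult.commute power2_eq_1_iff power_mult)

text \<open>
  Squaring is two-to-one on nonzero elements.
\<close>
lemma card_nonzero_squares: "card {x::'a. x \<noteq> 0 \<and> is_square x} = half_order"
proof -
  have "2 * card ((\<lambda>x::'a. x\<^sup>2) ` (UNIV - {0})) = card (UNIV - {0::'a})"
  proof (rule card_image_fibres)
    fix a :: 'a assume "a \<in> UNIV - {0}"
    then have "{x \<in> UNIV - {0}. x\<^sup>2 = a\<^sup>2} = {a, - a}" "a \<noteq> - a"
      using minus_neq_self[of a] by (auto simp: power2_eq_iff)
    then show "card {x \<in> UNIV - {0}. x\<^sup>2 = a\<^sup>2} = 2" by simp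
  qed simp
  moreover have "(\<lambda>x::'a. x\<^sup>2) ` (UNIV - {0}) = {x. x \<noteq> 0 \<and> is_square x}"
    by (auto simp: is_nth_power_def)
  ultimately show ?thesis using half_order_facts(1) by (simp add: card_Diff_singleton card_field)
qed

text \<open>
  The nonzero squares are \<open>half_order\<close> many roots of
  \<open>X ^ half_order - 1\<close>, hence all its roots.
\<close>
lemma euler_criterion: assumes "x \<noteq> 0" shows "is_square x \<longleftrightarrow> x ^ half_order = (1::'a)"
proof -
  have "{x::'a. x \<noteq> 0 \<and> is_square x} \<subseteq> {x. x ^ half_order = 1}"
  proof clarify
    fix y :: 'a assume "y \<noteq> 0" "is_square y"
    then obtain z where "y = z\<^sup>2" "z \<noteq> 0" by (auto elim!: is_nth_powerE)
    then show "y ^ half_order = 1" using power_card_minus_1[of z] half_order_facts(1) by (simp flip: power_mult)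
  qed
  moreover have "card {x::'a. x ^ half_order = 1} \<le> half_order" "finite {x::'a. x ^ half_order = 1}" using card_power_eq_le half_order_facts(3) by auto
  ultimately have "{x::'a. x \<noteq> 0 \<and> is_square x} = {x. x ^ half_order = 1}"
    by (intro card_seteq) (auto simp: card_nonzero_squares)
  with assms show ?thesis by blast
qed

lemma card_nonsquares: "card {x::'a. \<not> is_square x} = half_order"
proof -
  have "{x::'a. \<not> is_square x} = (UNIV - {0}) - {x. x \<noteq> 0 \<and> is_square x}" by auto
  then have "card {x::'a. \<not> is_square x} = (r\<^sup>2 - 1) - half_order"
    by (subst \<open>_ = _\<close>, subst card_Diff_subset) (auto simp: card_Diff_singleton card_field card_nonzero_squares)
  with half_order_facts(1) show ?thesis by simp
qed

lemma is_square_mult_iff: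
  assumes "x \<noteq> 0" "y \<noteq> 0" shows "is_square (x * y) \<longleftrightarrow> (is_square x \<longleftrightarrow> is_square (y::'a))"
  using assms power_half_order[of x] power_half_order[of y] minus_one_neq_one
  by (auto simp: euler_criterion power_mult_distrib)

lemma is_square_inverse_iff: "is_square (inverse x) \<longleftrightarrow> is_square (x::'a)"
proof (cases "x = 0")
  case False
  then have "is_square (x * inverse x)" by simp
  with False show ?thesis by (subst (asm) is_square_mult_iff) auto
qed auto

lemma is_square_minus_one: "is_square (-1::'a)"
  by (subst euler_criterion) (auto simp: half_order_facts(2))

lemma is_square_minus_iff: "is_square (- x) \<longleftrightarrow> is_square (x::'a)"
  using is_square_mult_iff[of "-1" x] is_square_minus_one by (cases "x = 0") auto

lemma \<sigma>_0: "\<sigma> 0 = 0" and \<sigma>_1: "\<sigma> 1 = 1" using r_ge_3 by (auto simp: \<sigma>_power)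
lemma \<sigma>_mult: "\<sigma> (x * y) = \<sigma> x * \<sigma> y" by (simp add: \<sigma>_power power_mult_distrib)
lemma \<sigma>_inverse: "\<sigma> (inverse x) = inverse (\<sigma> x)" by (simp add: \<sigma>_power power_inverse)
lemma \<sigma>_minus: "\<sigma> (- x) = - \<sigma> x" using odd_r by (simp add: \<sigma>_power)
lemma \<sigma>_diff: "\<sigma> (x - y) = \<sigma> x - \<sigma> y" using \<sigma>_add[of x "-y"] \<sigma>_minus by simp

lemma \<sigma>_\<sigma>: "\<sigma> (\<sigma> x) = x"
proof (cases "x = 0")
  case False
  have "x ^ r\<^sup>2 = x * x ^ (r\<^sup>2 - 1)" using r_ge_3 by (simp flip: power_Suc)
  then have "x ^ r\<^sup>2 = x" using power_card_minus_1[OF False] by simp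
  then show ?thesis by (simp add: \<sigma>_power power2_eq_square flip: power_mult)
qed (simp add: \<sigma>_0)

lemma \<sigma>_inj: "\<sigma> x = \<sigma> y \<longleftrightarrow> x = y" by (metis \<sigma>_\<sigma>)
lemma \<sigma>_eq_0_iff: "\<sigma> x = 0 \<longleftrightarrow> x = 0" using \<sigma>_inj[of x 0] by (simp add: \<sigma>_0)
lemma field_aut_\<sigma>: "field_aut \<sigma>"
  unfolding field_aut_def using \<sigma>_\<sigma> \<sigma>_add \<sigma>_mult by (metis bijI')

lemma is_square_\<sigma>_iff: "is_square (\<sigma> x) \<longleftrightarrow> is_square x"
proof -
  have "is_square (\<sigma> y)" if "is_square y" for y
    using that by (auto simp: is_nth_power_def power2_eq_square \<sigma>_mult)
  then show ?thesis by (metis \<sigma>_\<sigma>)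
qed

lemma \<sigma>_eq_mult_iff: "x \<noteq> 0 \<Longrightarrow> \<sigma> x = c * x \<longleftrightarrow> x ^ (r - 1) = c"
  using r_ge_3 by (cases r) (auto simp: \<sigma>_power)

lemma mult_\<sigma>: "x * \<sigma> x = x ^ (r + 1)" by (simp add: \<sigma>_power)

text \<open>
  This and the next lemma hold because both \<open>r - 1\<close> and \<open>r + 1\<close>
  divide \<open>half_order = (r - 1) (r + 1) / 2\<close>, as \<open>r\<close> is odd.
  So neither \<open>\<sigma>\<close> nor its composition with inversion fixes a nonsquare.
\<close>
lemma is_square_if_\<sigma>_fixed: assumes "\<sigma> x = x" shows "is_square x"
proof (cases "x = 0")
  case False
  then have "x ^ (r - 1) = 1" using \<sigma>_eq_mult_iff[of x 1] assms by simp
  with False show ?thesis by (subst euler_criterion) (auto simp: half_order_facts(5) power_mult)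
qed auto

lemma is_square_if_norm_one: assumes "x * \<sigma> x = 1" shows "is_square x"
proof -
  have "x \<noteq> 0" using assms by auto
  moreover have "(x ^ (r + 1)) ^ ((r - 1) div 2) = 1" using assms by (simp only: mult_\<sigma> power_one)
  then have "x ^ ((r - 1) div 2 * (r + 1)) = 1" by (simp only: power_mult[symmetric] mult.commute)
  ultimately show ?thesis using half_order_facts(4) by (simp add: euler_criterion)
qed

lemma \<sigma>_not_id: "\<sigma> \<noteq> id"
proof
  assume *: "\<sigma> = id"
  have "UNIV - {0} \<subseteq> {x::'a. x ^ (r - 1) = 1}" using \<sigma>_eq_mult_iff[of _ 1] by (auto simp: *)
  then have "card (UNIV - {0::'a}) \<le> card {x::'a. x ^ (r - 1) = 1}" by (intro card_mono) auto
  also have "\<dots> \<le> r - 1" using r_ge_3 by (intro card_power_eq_le) auto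
  finally have "r\<^sup>2 - 1 \<le> r - 1" by (simp add: card_Diff_singleton card_field)
  moreover have "r * r > r * 1" using r_ge_3 by (intro mult_strict_left_mono) auto
  ultimately show False using r_ge_3 unfolding power2_eq_square by linarith
qed

text \<open>
  For \<open>d = t - \<tau> t \<noteq> 0\<close> one has
  \<open>\<tau> d = - d\<close>, and the field is the direct sum of the fixed field
  \<open>F\<close> and \<open>d F\<close>, the decomposition into symmetric and antisymmetric
  parts. So \<open>q = card F ^ 2\<close>.
\<close>
lemma card_fixed_field:
  assumes "field_aut \<tau>" "\<tau> \<noteq> id" "\<tau> \<circ> \<tau> = id"
  shows "card {x::'a. \<tau> x = x} = r"
proof -
  have add: "\<tau> (x + y) = \<tau> x + \<tau> y" and mult: "\<tau> (x * y) = \<tau> x * \<tau> y" for x y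
    using assms(1) by (auto simp: field_aut_def)
  have \<tau>0: "\<tau> 0 = 0" using field_aut_0 assms(1) .
  have minus: "\<tau> (- x) = - \<tau> x" for x using add[of x "- x"] \<tau>0 by (simp add: add_eq_0_iff)
  have inv: "\<tau> (\<tau> x) = x" for x using assms(3) by (metis comp_apply id_apply)
  have div: "\<tau> (x / y) = \<tau> x / \<tau> y" for x y
  proof (cases "y = 0")
    case False
    have "\<tau> y \<noteq> 0" using False inv \<tau>0 by metis
    then show ?thesis using mult[of "x / y" y] False by (simp add: field_simps)
  qed (simp add: \<tau>0)
  obtain t where t: "\<tau> t \<noteq> t" using assms(2) by (metis eq_id_iff)
  define d where "d = t - \<tau> t"
  have d: "d \<noteq> 0" "\<tau> d = - d" using t add[of t "- \<tau> t"] by (auto simp: d_def minus inv)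
  have two: "\<tau> 2 = 2" using add[of 1 1] field_aut_1[OF assms(1)] by simp
  let ?F = "{x::'a. \<tau> x = x}"
  have "bij_betw (\<lambda>(x, y). x + d * y) (?F \<times> ?F) UNIV"
    unfolding bij_betw_def
  proof
    show "inj_on (\<lambda>(x, y). x + d * y) (?F \<times> ?F)"
    proof (rule inj_onI, clarify)
      fix x y x' y' assume F: "\<tau> x = x" "\<tau> y = y" "\<tau> x' = x'" "\<tau> y' = y'" and e: "x + d * y = x' + d * y'"
      then have "\<tau> (x + d * y) = \<tau> (x' + d * y')" by simp
      then have "x - d * y = x' - d * y'" by (simp add: add mult F d)
      with e have "(x + d * y) + (x - d * y) = (x' + d * y') + (x' - d * y')"
        "(x + d * y) - (x - d * y) = (x' + d * y') - (x' - d * y')" by simp_all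
      then have "2 * x = 2 * x'" "2 * (d * y) = 2 * (d * y')" by (simp_all only: mult_2) (simp_all add: algebra_simps)
      then show "x = x' \<and> y = y'" using two_neq_0 d by auto
    qed
    have "x \<in> (\<lambda>(x, y). x + d * y) ` (?F \<times> ?F)" for x
    proof (rule image_eqI)
      show "x = (case ((x + \<tau> x) / 2, (x - \<tau> x) / (2 * d)) of (x, y) \<Rightarrow> x + d * y)"
        using two_neq_0 d by (simp add: field_simps)
      have "\<tau> (x - \<tau> x) = - (x - \<tau> x)" using add[of x "- \<tau> x"] by (simp add: minus inv)
      then have "\<tau> ((x - \<tau> x) / (2 * d)) = (x - \<tau> x) / (2 * d)"
        by (simp only: div mult two d mult_minus_right minus_divide_divide)
      moreover have "\<tau> ((x + \<tau> x) / 2) = (x + \<tau> x) / 2" by (simp add: add div inv two add.commute)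
      ultimately show "((x + \<tau> x) / 2, (x - \<tau> x) / (2 * d)) \<in> ?F \<times> ?F" by simp
    qed
    then show "(\<lambda>(x, y). x + d * y) ` (?F \<times> ?F) = UNIV" by blast
  qed
  then have "card (?F \<times> ?F) = CARD('a)" by (rule bij_betw_same_card)
  then have "(card ?F)\<^sup>2 = r\<^sup>2" by (simp add: card_cartesian_product card_field power2_eq_square)
  then show ?thesis by simp
qed

text \<open>
  Both sides have \<open>r\<close> elements, and a field with \<open>r\<close> elements
  consists of roots of \<open>X ^ r - X\<close>.
\<close>
lemma fixed_field_eq:
  assumes "field_aut \<tau>" "\<tau> \<noteq> id" "\<tau> \<circ> \<tau> = id"
  shows "{x. \<tau> x = x} = {x. \<sigma> x = x}"
proof (rule card_subset_eq)
  let ?F = "{x::'a. \<tau> x = x}"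
  have card: "card (?F - {0}) = r - 1"
    using card_fixed_field[OF assms] field_aut_0[OF assms(1)] by (simp add: card_Diff_singleton)
  show "?F \<subseteq> {x. \<sigma> x = x}"
  proof clarify
    fix x :: 'a assume "\<tau> x = x"
    show "\<sigma> x = x"
    proof (cases "x = 0")
      case False
      then have "x ^ card (?F - {0}) = 1"
        using \<open>\<tau> x = x\<close> assms(1) by (intro power_card_mult_closed) (auto simp: field_aut_def)
      then show ?thesis using \<sigma>_eq_mult_iff[OF False, of 1] by (simp add: card)
    qed (simp add: \<sigma>_0)
  qed
  have "\<sigma> \<circ> \<sigma> = id" by (auto simp: \<sigma>_\<sigma>)
  then show "card ?F = card {x. \<sigma> x = x}" using card_fixed_field assms field_aut_\<sigma> \<sigma>_not_id by auto
qed auto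

text \<open>
  Two involutions have the same fixed field, so the trace \<open>t + \<tau> t\<close> and
  the norm \<open>t * \<tau> t\<close> are fixed by \<open>\<sigma>\<close>. Hence
  \<open>\<sigma> t\<close> is a root of \<open>(X - t) (X - \<tau> t)\<close>, and it
  is not \<open>t\<close> unless \<open>t\<close> lies in the fixed field.
\<close>
lemma aut_involution_eq: "aut_involution = \<sigma>"
  unfolding aut_involution_def
proof (rule the_equality)
  show "field_aut \<sigma> \<and> \<sigma> \<noteq> id \<and> \<sigma> \<circ> \<sigma> = id" using field_aut_\<sigma> \<sigma>_not_id by (auto simp: \<sigma>_\<sigma>)
next
  fix \<tau> :: "'a \<Rightarrow> 'a" assume "field_aut \<tau> \<and> \<tau> \<noteq> id \<and> \<tau> \<circ> \<tau> = id"
  then have \<tau>: "field_aut \<tau>" "\<tau> \<noteq> id" "\<tau> \<circ> \<tau> = id" by auto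
  have F: "\<tau> x = x \<longleftrightarrow> \<sigma> x = x" for x using fixed_field_eq[OF \<tau>] by blast
  have inv: "\<tau> (\<tau> x) = x" for x using \<tau>(3) by (metis comp_apply id_apply)
  have add: "\<tau> (x + y) = \<tau> x + \<tau> y" and mult: "\<tau> (x * y) = \<tau> x * \<tau> y" for x y
    using \<tau>(1) by (auto simp: field_aut_def)
  show "\<tau> = \<sigma>"
  proof
    fix t show "\<tau> t = \<sigma> t"
    proof (cases "\<tau> t = t")
      case False
      have "\<sigma> (t + \<tau> t) = t + \<tau> t" "\<sigma> (t * \<tau> t) = t * \<tau> t"
        by (simp_all flip: F add: inv add mult ac_simps)
      then have "\<sigma> t + \<sigma> (\<tau> t) = t + \<tau> t" "\<sigma> t * \<sigma> (\<tau> t) = t * \<tau> t" by (simp_all add: \<sigma>_add \<sigma>_mult)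
      then have "\<sigma> t * (t + \<tau> t - \<sigma> t) = t * \<tau> t" by (metis add_diff_cancel_left')
      then have "(\<sigma> t - t) * (\<sigma> t - \<tau> t) = 0" by (simp add: algebra_simps)
      moreover have "\<sigma> t \<noteq> t" using False F by blast
      ultimately show ?thesis by simp
    qed (use F in metis)
  qed
qed

end

lemma square_order_field_Frobenius:
  fixes p f :: nat
  assumes "prime p" "odd p" "f > 0" "CARD('a::{field,finite}) = p ^ (2 * f)"
  shows "square_order_field (p ^ f) (\<lambda>x::'a. x ^ (p ^ f))"
proof
  have pr: "prime CHAR('a)" by (intro prime_CHAR_semidom finite_imp_CHAR_pos) auto
  have "CHAR('a) dvd p ^ (2 * f)" using CHAR_dvd_CARD[where ?'a='a] assms(4) by simp
  then have "CHAR('a) dvd p" using pr prime_dvd_power by blast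
  then have "CHAR('a) = p" using pr assms(1) by (simp add: primes_dvd_imp_eq)
  then show "(x + y) ^ p ^ f = x ^ p ^ f + y ^ p ^ f" for x y :: 'a
    by (intro freshmans_dream'[OF pr]) simp
qed (use assms in \<open>auto simp: power_mult mult.commute\<close>)

section \<open>Semilinear fractional maps in homogeneous coordinates\<close>

text \<open>
  The point of the projective line with homogeneous coordinates \<open>(x : y)\<close>.
\<close>
definition proj_point :: "'a::field \<Rightarrow> 'a \<Rightarrow> 'a option" where
  "proj_point x y = (if y = 0 then None else Some (x / y))"

lemma proj_point_exhaust:
  obtains x y where "x \<noteq> 0 \<or> y \<noteq> 0" "\<xi> = proj_point x y"
proof (cases \<xi>)
  case None
  then show thesis using that[of 1 0] by (simp add: proj_point_def)
next
  case (Some a)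
  then show thesis using that[of a 1] by (simp add: proj_point_def)
qed

lemma proj_point_eq_iff:
  assumes "x \<noteq> 0 \<or> y \<noteq> 0" "x' \<noteq> 0 \<or> y' \<noteq> 0"
  shows "proj_point x y = proj_point x' y' \<longleftrightarrow> x * y' = x' * y"
  using assms by (auto simp: proj_point_def field_simps)

lemma proj_point_scale: "c \<noteq> 0 \<Longrightarrow> proj_point (c * x) (c * y) = proj_point x y"
  by (simp add: proj_point_def)

lemma linear_image_nonzero:
  fixes a b c d x y :: "'a::field"
  assumes "a * d - b * c \<noteq> 0" "x \<noteq> 0 \<or> y \<noteq> 0"
  shows "a * x + b * y \<noteq> 0 \<or> c * x + d * y \<noteq> 0"
proof (rule ccontr)
  assume "\<not> ?thesis"
  then have "d * (a * x + b * y) - b * (c * x + d * y) = 0" "a * (c * x + d * y) - c * (a * x + b * y) = 0" by simp_all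
  then have "(a * d - b * c) * x = 0" "(a * d - b * c) * y = 0" by (simp_all add: algebra_simps)
  with assms show False by simp
qed

lemma field_aut_eq_0_iff: "field_aut \<tau> \<Longrightarrow> \<tau> x = 0 \<longleftrightarrow> x = 0"
proof
  assume "field_aut \<tau>" "\<tau> x = 0"
  then have "\<tau> x = \<tau> 0" "inj \<tau>" by (simp_all add: field_aut_0) (simp add: field_aut_def bij_def)
  then show "x = 0" by (simp add: inj_eq)
qed (simp add: field_aut_0)

lemma field_aut_divide: assumes "field_aut \<tau>" shows "\<tau> (x / y) = \<tau> x / \<tau> y"
proof (cases "y = 0")
  case True
  then show ?thesis by (simp add: field_aut_0[OF assms])
next
  case False
  then have "\<tau> y \<noteq> 0" by (simp add: field_aut_eq_0_iff[OF assms])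
  moreover have mult: "\<tau> (u * v) = \<tau> u * \<tau> v" for u v using assms by (auto simp: field_aut_def)
  have "\<tau> (x / y) * \<tau> y = \<tau> (x / y * y)" by (rule mult[symmetric])
  ultimately show ?thesis using False by (simp add: nonzero_eq_divide_eq)
qed

lemma semilin_frac_proj_point:
  assumes "field_aut \<tau>" "x \<noteq> 0 \<or> y \<noteq> 0"
  shows "semilin_frac A \<tau> (proj_point x y) =
    proj_point (A$1$1 * \<tau> x + A$1$2 * \<tau> y) (A$2$1 * \<tau> x + A$2$2 * \<tau> y)"
proof -
  have iff: "\<tau> u = 0 \<longleftrightarrow> u = 0" for u by (rule field_aut_eq_0_iff[OF assms(1)])
  show ?thesis
  proof (cases "y = 0")
    case True
    with assms(2) have "\<tau> y = 0" "\<tau> x \<noteq> 0" by (simp_all add: iff)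
    with True show ?thesis by (simp add: proj_point_def semilin_frac_def)
  next
    case False
    then have "\<tau> y \<noteq> 0" by (simp add: iff)
    then have "A$i$1 * (\<tau> x / \<tau> y) + A$i$2 = (A$i$1 * \<tau> x + A$i$2 * \<tau> y) / \<tau> y" for i
      by (simp add: add_divide_distrib)
    with False \<open>\<tau> y \<noteq> 0\<close> show ?thesis
      by (simp add: proj_point_def semilin_frac_def field_aut_divide[OF assms(1)])
  qed
qed

context square_order_field
begin

section \<open>The group M(q)\<close>

text \<open>
  The field automorphism that accompanies a determinant \<open>e\<close> in
  \<open>M(q)\<close>. It satisfies
  \<open>twist (x * y) = twist x \<circ> twist y\<close> on nonzero elements, which
  is what makes \<open>M(q)\<close> a group.
\<close>
definition twist :: "'a \<Rightarrow> 'a \<Rightarrow> 'a" where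
  "twist e = (if is_square e then id else \<sigma>)"

lemma twist_simps [simp]:
  "twist e 0 = 0" "twist e 1 = 1" "twist e (x + y) = twist e x + twist e y"
  "twist e (x * y) = twist e x * twist e y" "twist e (x - y) = twist e x - twist e y"
  "twist e (- x) = - twist e x" "twist e (inverse x) = inverse (twist e x)"
  "twist e (twist e x) = x" "twist e x = 0 \<longleftrightarrow> x = 0"
  by (simp_all add: twist_def \<sigma>_0 \<sigma>_1 \<sigma>_add \<sigma>_mult \<sigma>_diff \<sigma>_minus \<sigma>_inverse \<sigma>_\<sigma> \<sigma>_eq_0_iff)

lemma field_aut_twist: "field_aut (twist e)"
proof -
  have "field_aut (id :: 'a \<Rightarrow> 'a)" by (simp add: field_aut_def)
  then show ?thesis using field_aut_\<sigma> by (simp add: twist_def)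
qed

lemma is_square_twist_iff: "is_square (twist e x) \<longleftrightarrow> is_square x"
  by (simp add: twist_def is_square_\<sigma>_iff)

lemma twist_twist_arg: "twist (twist e x) = twist x"
  unfolding twist_def[of "twist e x"] twist_def[of x] by (simp add: is_square_twist_iff)

lemma twist_mult_arg: "x \<noteq> 0 \<Longrightarrow> y \<noteq> 0 \<Longrightarrow> twist (x * y) z = twist x (twist y z)"
  by (simp add: twist_def is_square_mult_iff \<sigma>_\<sigma>)

definition twisted_frac :: "'a \<Rightarrow> 'a \<Rightarrow> 'a \<Rightarrow> 'a \<Rightarrow> 'a option \<Rightarrow> 'a option" where
  "twisted_frac a b c d = semilin_frac (vector [vector [a, b], vector [c, d]]) (twist (a * d - b * c))"

lemma M_perms_eq: "(M_perms :: ('a option \<Rightarrow> 'a option) set) = {twisted_frac a b c d | a b c d. a * d - b * c \<noteq> 0}"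
proof -
  have "(M_perms :: ('a option \<Rightarrow> 'a option) set) = {semilin_frac A (twist (det A)) | A. det A \<noteq> 0}"
    unfolding M_perms_def aut_involution_eq twist_def by auto
  also have "\<dots> = {twisted_frac a b c d | a b c d. a * d - b * c \<noteq> 0}"
  proof safe
    fix A :: "'a^2^2" assume A: "det A \<noteq> 0"
    have "A = vector [vector [A$1$1, A$1$2], vector [A$2$1, A$2$2]]"
      by (simp add: vec_eq_iff forall_2)
    then show "\<exists>a b c d. semilin_frac A (twist (det A)) = twisted_frac a b c d \<and> a * d - b * c \<noteq> 0"
      using A unfolding twisted_frac_def by (intro exI[of _ "A$1$1"] exI[of _ "A$1$2"] exI[of _ "A$2$1"] exI[of _ "A$2$2"]) (simp add: det_2)
  next
    fix a b c d :: 'a assume e: "a * d - b * c \<noteq> 0"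
    then show "\<exists>A. twisted_frac a b c d = semilin_frac A (twist (det A)) \<and> det A \<noteq> 0"
      by (intro exI[of _ "vector [vector [a, b], vector [c, d]]"]) (simp add: twisted_frac_def det_2)
  qed
  finally show ?thesis .
qed

lemma twisted_frac_in_M: "a * d - b * c \<noteq> 0 \<Longrightarrow> twisted_frac a b c d \<in> M_perms"
  by (auto simp: M_perms_eq)

lemma twisted_frac_proj_point:
  assumes "x \<noteq> 0 \<or> y \<noteq> 0"
  shows "twisted_frac a b c d (proj_point x y) =
    (let t = twist (a * d - b * c) in proj_point (a * t x + b * t y) (c * t x + d * t y))"
  unfolding twisted_frac_def
  by (subst semilin_frac_proj_point[OF field_aut_twist assms]) (simp add: Let_def)

lemma id_in_M: "id \<in> (M_perms :: ('a option \<Rightarrow> 'a option) set)"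
proof -
  have "twisted_frac 1 0 0 1 \<xi> = \<xi>" for \<xi> :: "'a option"
  proof -
    obtain x y where "x \<noteq> 0 \<or> y \<noteq> 0" "\<xi> = proj_point x y" by (rule proj_point_exhaust)
    then show ?thesis by (simp add: twisted_frac_proj_point twist_def)
  qed
  then have "twisted_frac 1 0 0 1 = id" by auto
  then show ?thesis using twisted_frac_in_M[where a=1 and b=0 and c=0 and d=1] by simp
qed

text \<open>
  The composition has the matrix \<open>A * t B\<close>, where \<open>t\<close> is the
  automorphism of the first map applied entrywise; its determinant
  \<open>det A * t (det B)\<close> carries the composition of the two automorphisms.
\<close>
lemma comp_in_M:
  assumes "g \<in> M_perms" "g' \<in> (M_perms :: ('a option \<Rightarrow> 'a option) set)" shows "g \<circ> g' \<in> M_perms"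
proof -
  obtain a b c d where e: "a * d - b * c \<noteq> 0" and g: "g = twisted_frac a b c d"
    using assms(1) by (auto simp: M_perms_eq)
  obtain a' b' c' d' where e': "a' * d' - b' * c' \<noteq> 0" and g': "g' = twisted_frac a' b' c' d'"
    using assms(2) by (auto simp: M_perms_eq)
  define t where "t = twist (a * d - b * c)"
  define t' where "t' = twist (a' * d' - b' * c')"
  define A B C D where "A = a * t a' + b * t c'" and "B = a * t b' + b * t d'"
    and "C = c * t a' + d * t c'" and "D = c * t b' + d * t d'"
  have det: "A * D - B * C = (a * d - b * c) * t (a' * d' - b' * c')"
    unfolding A_def B_def C_def D_def t_def by (simp add: algebra_simps)
  have t0: "t (a' * d' - b' * c') \<noteq> 0" using e' unfolding t_def twist_simps(9) .
  have tt: "twist (A * D - B * C) x = t (t' x)" for x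
    unfolding det twist_mult_arg[OF e t0] by (simp add: t_def t'_def twist_twist_arg del: twist_simps)
  have "(g \<circ> g') \<xi> = twisted_frac A B C D \<xi>" for \<xi>
  proof -
    obtain x y where xy: "x \<noteq> 0 \<or> y \<noteq> 0" "\<xi> = proj_point x y" by (rule proj_point_exhaust)
    have nz: "a' * t' x + b' * t' y \<noteq> 0 \<or> c' * t' x + d' * t' y \<noteq> 0"
      by (rule linear_image_nonzero[OF e']) (use xy in \<open>simp add: t'_def\<close>)
    have "(g \<circ> g') \<xi> = proj_point (A * t (t' x) + B * t (t' y)) (C * t (t' x) + D * t (t' y))"
      unfolding comp_apply g g' xy(2) twisted_frac_proj_point[OF xy(1)] Let_def
      unfolding t'_def[symmetric] twisted_frac_proj_point[OF nz] Let_def t_def[symmetric]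
      unfolding A_def B_def C_def D_def by (simp add: t_def algebra_simps)
    then show ?thesis unfolding xy(2) twisted_frac_proj_point[OF xy(1)] Let_def tt .
  qed
  then have "g \<circ> g' = twisted_frac A B C D" by blast
  moreover have "A * D - B * C \<noteq> 0" unfolding det using e t0 by simp
  ultimately show ?thesis by (simp add: twisted_frac_in_M)
qed

text \<open>
  The inverse is given by the adjugate matrix with \<open>t\<close> applied to its entries;
  composing yields multiplication by the determinant, which fixes all projective points.
\<close>
lemma right_inverse_in_M:
  assumes "g \<in> (M_perms :: ('a option \<Rightarrow> 'a option) set)" shows "\<exists>h\<in>M_perms. g \<circ> h = id"
proof -
  obtain a b c d where e: "a * d - b * c \<noteq> 0" and g: "g = twisted_frac a b c d"
    using assms(1) by (auto simp: M_perms_eq)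
  define t where "t = twist (a * d - b * c)"
  let ?h = "twisted_frac (t d) (- t b) (- t c) (t a)"
  have det: "t d * t a - (- t b) * (- t c) = t (a * d - b * c)" by (simp add: t_def algebra_simps)
  have t0: "t (a * d - b * c) \<noteq> 0" using e unfolding t_def twist_simps(9) .
  have tt: "twist (t d * t a - (- t b) * (- t c)) = t"
    unfolding det unfolding t_def twist_twist_arg ..
  have "(g \<circ> ?h) \<xi> = \<xi>" for \<xi>
  proof -
    obtain x y where xy: "x \<noteq> 0 \<or> y \<noteq> 0" "\<xi> = proj_point x y" by (rule proj_point_exhaust)
    have nz: "t d * t x + (- t b) * t y \<noteq> 0 \<or> (- t c) * t x + t a * t y \<noteq> 0"
    proof (rule linear_image_nonzero)
      show "t d * t a - (- t b) * (- t c) \<noteq> 0" unfolding det by (rule t0)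
      show "t x \<noteq> 0 \<or> t y \<noteq> 0" using xy by (simp add: t_def)
    qed
    have "(g \<circ> ?h) \<xi> = proj_point ((a * d - b * c) * x) ((a * d - b * c) * y)"
      unfolding comp_apply g xy(2) twisted_frac_proj_point[OF xy(1)] Let_def tt
      unfolding twisted_frac_proj_point[OF nz] Let_def t_def[symmetric]
      by (simp add: t_def algebra_simps)
    then show ?thesis using proj_point_scale[OF e] xy(2) by simp
  qed
  then have "g \<circ> ?h = id" by auto
  moreover have "?h \<in> M_perms" by (rule twisted_frac_in_M) (simp only: det t0 not_False_eq_True)
  ultimately show ?thesis by blast
qed

lemma inverse_in_M:
  assumes "g \<in> (M_perms :: ('a option \<Rightarrow> 'a option) set)" obtains h where "h \<in> M_perms" "g \<circ> h = id" "h \<circ> g = id"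
proof -
  obtain h where h: "h \<in> M_perms" "g \<circ> h = id" using right_inverse_in_M[OF assms] by blast
  obtain k where k: "k \<in> M_perms" "h \<circ> k = id" using right_inverse_in_M[OF h(1)] by blast
  have "g = g \<circ> (h \<circ> k)" using k by simp
  also have "\<dots> = k" unfolding comp_assoc[symmetric] h(2) by simp
  finally show ?thesis using that h k by auto
qed

lemma bij_M: "g \<in> (M_perms :: ('a option \<Rightarrow> 'a option) set) \<Longrightarrow> bij g"
  by (rule inverse_in_M, assumption) (rule o_bij)

text \<open>
  The fractional linear map with zero \<open>\<eta>\<close> and pole \<open>\<xi>\<close> is
  scaled so that \<open>\<zeta>\<close> goes to \<open>1\<close>. All coordinates are first
  moved by \<open>t\<close>; the determinant is then the \<open>t\<close>-image of the product
  of the three differences \<open>D\<^sub>1\<^sub>2\<close>, \<open>D\<^sub>1\<^sub>3\<close>,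
  \<open>D\<^sub>2\<^sub>3\<close>, whose quadratic character does not depend on
  \<open>t\<close>. So \<open>t\<close> can be chosen to match it.
\<close>
lemma three_transitive:
  assumes "distinct [\<xi>, \<eta>, \<zeta>::'a option]"
  obtains g where "g \<in> M_perms" "g \<xi> = None" "g \<eta> = Some 0" "g \<zeta> = Some 1"
proof -
  obtain x\<^sub>1 y\<^sub>1 where 1: "x\<^sub>1 \<noteq> 0 \<or> y\<^sub>1 \<noteq> 0" "\<xi> = proj_point x\<^sub>1 y\<^sub>1" by (rule proj_point_exhaust)
  obtain x\<^sub>2 y\<^sub>2 where 2: "x\<^sub>2 \<noteq> 0 \<or> y\<^sub>2 \<noteq> 0" "\<eta> = proj_point x\<^sub>2 y\<^sub>2" by (rule proj_point_exhaust)
  obtain x\<^sub>3 y\<^sub>3 where 3: "x\<^sub>3 \<noteq> 0 \<or> y\<^sub>3 \<noteq> 0" "\<zeta> = proj_point x\<^sub>3 y\<^sub>3" by (rule proj_point_exhaust)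
  define D\<^sub>1\<^sub>2 D\<^sub>1\<^sub>3 D\<^sub>2\<^sub>3 where D_def: "D\<^sub>1\<^sub>2 = x\<^sub>2 * y\<^sub>1 - x\<^sub>1 * y\<^sub>2" "D\<^sub>1\<^sub>3 = y\<^sub>1 * x\<^sub>3 - x\<^sub>1 * y\<^sub>3" "D\<^sub>2\<^sub>3 = y\<^sub>2 * x\<^sub>3 - x\<^sub>2 * y\<^sub>3"
  have D: "D\<^sub>1\<^sub>2 \<noteq> 0" "D\<^sub>1\<^sub>3 \<noteq> 0" "D\<^sub>2\<^sub>3 \<noteq> 0"
    using assms unfolding 1 2 3 D_def
    by (auto simp: proj_point_eq_iff[OF 1(1) 2(1)] proj_point_eq_iff[OF 1(1) 3(1)] proj_point_eq_iff[OF 2(1) 3(1)] mult.commute)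
  define t where "t = twist (D\<^sub>1\<^sub>2 * D\<^sub>1\<^sub>3 * D\<^sub>2\<^sub>3)"
  define a b c d where abcd: "a = t D\<^sub>1\<^sub>3 * t y\<^sub>2" "b = - (t D\<^sub>1\<^sub>3 * t x\<^sub>2)" "c = t D\<^sub>2\<^sub>3 * t y\<^sub>1" "d = - (t D\<^sub>2\<^sub>3 * t x\<^sub>1)"
  have "a * d - b * c = t D\<^sub>1\<^sub>3 * t D\<^sub>2\<^sub>3 * (t x\<^sub>2 * t y\<^sub>1 - t x\<^sub>1 * t y\<^sub>2)"
    unfolding abcd by (simp add: algebra_simps)
  also have "\<dots> = t D\<^sub>1\<^sub>3 * t D\<^sub>2\<^sub>3 * t D\<^sub>1\<^sub>2" unfolding t_def by (simp only: D_def(1) twist_simps)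
  also have "\<dots> = t (D\<^sub>1\<^sub>2 * D\<^sub>1\<^sub>3 * D\<^sub>2\<^sub>3)" unfolding t_def by (simp only: twist_simps ac_simps)
  finally have det: "a * d - b * c = t (D\<^sub>1\<^sub>2 * D\<^sub>1\<^sub>3 * D\<^sub>2\<^sub>3)" .
  have tw: "twist (a * d - b * c) = t" unfolding det unfolding t_def twist_twist_arg ..
  have e: "a * d - b * c \<noteq> 0" unfolding det using D by (simp add: t_def)
  have val: "twisted_frac a b c d (proj_point x y) = proj_point (t (D\<^sub>1\<^sub>3 * (y\<^sub>2 * x - x\<^sub>2 * y))) (t (D\<^sub>2\<^sub>3 * (y\<^sub>1 * x - x\<^sub>1 * y)))" 
    if "x \<noteq> 0 \<or> y \<noteq> 0" for x y
  proof -
    have "a * t x + b * t y = t (D\<^sub>1\<^sub>3 * (y\<^sub>2 * x - x\<^sub>2 * y))" "c * t x + d * t y = t (D\<^sub>2\<^sub>3 * (y\<^sub>1 * x - x\<^sub>1 * y))"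
      unfolding abcd t_def twist_simps by (simp_all only: algebra_simps) simp_all
    then show ?thesis unfolding twisted_frac_proj_point[OF that] tw Let_def by simp
  qed
  have t0: "t 0 = 0" "t u = 0 \<longleftrightarrow> u = 0" for u by (simp_all add: t_def)
  show ?thesis
  proof
    show "twisted_frac a b c d \<in> M_perms" using e by (rule twisted_frac_in_M)
    show "twisted_frac a b c d \<xi> = None" unfolding 1(2) val[OF 1(1)]
      by (simp add: proj_point_def t0 mult.commute)
    have "y\<^sub>1 * x\<^sub>2 - x\<^sub>1 * y\<^sub>2 \<noteq> 0" using D(1) by (simp add: D_def(1) mult.commute)
    then show "twisted_frac a b c d \<eta> = Some 0" unfolding 2(2) val[OF 2(1)]
      using D by (simp add: proj_point_def t0 mult.commute[of x\<^sub>2 y\<^sub>2])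
    show "twisted_frac a b c d \<zeta> = Some 1" unfolding 3(2) val[OF 3(1)] D_def(2,3)[symmetric]
      using D by (simp add: proj_point_def t0 mult.commute)
  qed
qed

end

section \<open>Hyperbolic lines as chords of the conic\<close>

definition conic_vec :: "'a::field \<Rightarrow> 'a \<Rightarrow> 'a^3" where
  "conic_vec x y = vector [x\<^sup>2, x * y, y\<^sup>2]"

definition chord :: "'a::field option set \<Rightarrow> ('a^3) set" where
  "chord s = vec.span (\<Union> (conic_point ` s))"

lemma conic_vec_nth [simp]:
  "conic_vec x y $ 1 = x\<^sup>2" "conic_vec x y $ 2 = x * y" "conic_vec x y $ 3 = y\<^sup>2"
  by (simp_all add: conic_vec_def)

lemma conic_vec_neq_0: "x \<noteq> 0 \<or> y \<noteq> 0 \<Longrightarrow> conic_vec x y \<noteq> 0"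
  by (auto simp: vec_eq_iff forall_3)

lemma span_scaled_singleton:
  fixes v :: "'a::field^'n"
  assumes "c \<noteq> 0" shows "vec.span {c *s v} = vec.span {v}"
proof -
  have "v = inverse c *s (c *s v)" using assms by (simp add: vector_smult_assoc)
  then have "v \<in> vec.span {c *s v}" by (metis vec.span_base vec.span_scale singletonI)
  then show ?thesis by (auto simp: vec.span_eq vec.span_base vec.span_scale)
qed

lemma conic_point_proj_point:
  assumes "x \<noteq> 0 \<or> y \<noteq> 0"
  shows "conic_point (proj_point x y) = vec.span {conic_vec x y}"
proof (cases "y = 0")
  case True
  then have "conic_vec x y = (x\<^sup>2) *s vector [1, 0, 0]" by (simp add: vec_eq_iff forall_3)
  with True assms show ?thesis by (simp add: conic_point_def proj_point_def span_scaled_singleton)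
next
  case False
  then have "conic_vec x y = (y\<^sup>2) *s vector [(x / y)\<^sup>2, x / y, 1]"
    by (simp add: vec_eq_iff forall_3 power2_eq_square)
  with False show ?thesis by (simp add: conic_point_def proj_point_def span_scaled_singleton)
qed

lemma span_pair: "vec.span {u, v} = {k *s u + l *s v | k l. True}" for u v :: "'a::field^'n"
proof -
  have "vec.span ({u} \<union> {v}) = {k *s u + l *s v | k l. True}"
    unfolding vec.span_Un vec.span_singleton by blast
  then show ?thesis by (simp add: insert_commute)
qed

lemma chord_pair:
  assumes "x \<noteq> 0 \<or> y \<noteq> 0" "x' \<noteq> 0 \<or> y' \<noteq> 0"
  shows "chord {proj_point x y, proj_point x' y'} = vec.span {conic_vec x y, conic_vec x' y'}"
proof -
  have "chord {proj_point x y, proj_point x' y'} = vec.span (vec.span {conic_vec x y} \<union> vec.span {conic_vec x' y'})"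
    by (simp add: chord_def conic_point_proj_point[OF assms(1)] conic_point_proj_point[OF assms(2)])
  also have "\<dots> = vec.span ({conic_vec x y} \<union> {conic_vec x' y'})"
    unfolding vec.span_Un vec.span_span ..
  finally show ?thesis by (simp add: insert_commute)
qed

text \<open>
  The linear form \<open>y y' X - (x y' + x' y) Y + x x' Z\<close> vanishes on
  the chord and takes the value \<open>(u y - x v) (u y' - x' v)\<close> at the conic
  point over \<open>(u : v)\<close>.
\<close>
lemma conic_vec_in_chord:
  fixes x y x' y' u v :: "'a::field"
  assumes "conic_vec u v \<in> vec.span {conic_vec x y, conic_vec x' y'}"
  shows "u * y = x * v \<or> u * y' = x' * v"
proof -
  obtain k l where e: "conic_vec u v = k *s conic_vec x y + l *s conic_vec x' y'"
    using assms unfolding span_pair by blast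
  have "u\<^sup>2 = k * x\<^sup>2 + l * x'\<^sup>2" "u * v = k * (x * y) + l * (x' * y')" "v\<^sup>2 = k * y\<^sup>2 + l * y'\<^sup>2"
    using arg_cong[OF e, of "\<lambda>w. w $ 1"] arg_cong[OF e, of "\<lambda>w. w $ 2"] arg_cong[OF e, of "\<lambda>w. w $ 3"] by simp_all
  note c = this
  have "(u * y - x * v) * (u * y' - x' * v) = y * y' * u\<^sup>2 - (x * y' + x' * y) * (u * v) + x * x' * v\<^sup>2"
    by (simp add: power2_eq_square algebra_simps)
  also have "\<dots> = 0" unfolding c by (simp add: power2_eq_square algebra_simps)
  finally show ?thesis by simp
qed

lemma conic_point_subset_chord_iff:
  assumes "card s = 2" shows "conic_point \<xi> \<subseteq> chord s \<longleftrightarrow> \<xi> \<in> s"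
proof
  show "\<xi> \<in> s \<Longrightarrow> conic_point \<xi> \<subseteq> chord s" unfolding chord_def by (auto intro: vec.span_base)
next
  assume *: "conic_point \<xi> \<subseteq> chord s"
  obtain \<eta> \<zeta> where s: "s = {\<eta>, \<zeta>}" using assms by (meson card_2_iff)
  obtain x y where 1: "x \<noteq> 0 \<or> y \<noteq> 0" "\<eta> = proj_point x y" by (rule proj_point_exhaust)
  obtain x' y' where 2: "x' \<noteq> 0 \<or> y' \<noteq> 0" "\<zeta> = proj_point x' y'" by (rule proj_point_exhaust)
  obtain u v where 3: "u \<noteq> 0 \<or> v \<noteq> 0" "\<xi> = proj_point u v" by (rule proj_point_exhaust)
  have "conic_vec u v \<in> chord s"
    using * unfolding 3(2) conic_point_proj_point[OF 3(1)] by (auto intro: vec.span_base)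
  then have "conic_vec u v \<in> vec.span {conic_vec x y, conic_vec x' y'}"
    unfolding s 1(2) 2(2) chord_pair[OF 1(1) 2(1)] .
  then have "u * y = x * v \<or> u * y' = x' * v" by (rule conic_vec_in_chord)
  then show "\<xi> \<in> s" unfolding s 1(2) 2(2) 3(2)
    by (auto simp: proj_point_eq_iff[OF 3(1) 1(1)] proj_point_eq_iff[OF 3(1) 2(1)])
qed

lemma inj_conic_point: "inj (conic_point :: 'a::field option \<Rightarrow> _)"
proof (rule injI)
  fix \<xi> \<eta> :: "'a option" assume *: "conic_point \<xi> = conic_point \<eta>"
  obtain x y where 1: "x \<noteq> 0 \<or> y \<noteq> 0" "\<eta> = proj_point x y" by (rule proj_point_exhaust)
  obtain u v where 3: "u \<noteq> 0 \<or> v \<noteq> 0" "\<xi> = proj_point u v" by (rule proj_point_exhaust)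
  have "conic_vec u v \<in> vec.span {conic_vec x y, conic_vec x y}"
    using * unfolding 1(2) 3(2) conic_point_proj_point[OF 3(1)] conic_point_proj_point[OF 1(1)]
    by (metis insert_absorb2 singletonI vec.span_base)
  then have "u * y = x * v" using conic_vec_in_chord by blast
  then show "\<xi> = \<eta>" unfolding 1(2) 3(2) proj_point_eq_iff[OF 3(1) 1(1)] .
qed

lemma conic_points_of_chord: 
  assumes "card s = 2" shows "{P \<in> conic. P \<subseteq> chord s} = conic_point ` s"
  using conic_point_subset_chord_iff[OF assms] by (auto simp: conic_def)

lemma dim_chord:
  fixes s :: "'a::field option set"
  assumes "card s = 2" shows "vec.dim (chord s) = 2"
proof -
  obtain \<eta> \<zeta> where s: "s = {\<eta>, \<zeta>}" "\<eta> \<noteq> \<zeta>" using assms by (meson card_2_iff)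
  obtain x y where 1: "x \<noteq> 0 \<or> y \<noteq> 0" "\<eta> = proj_point x y" by (rule proj_point_exhaust)
  obtain x' y' where 2: "x' \<noteq> 0 \<or> y' \<noteq> 0" "\<zeta> = proj_point x' y'" by (rule proj_point_exhaust)
  have "conic_vec x y \<notin> vec.span {conic_vec x' y', conic_vec x' y'}"
    using conic_vec_in_chord[of x y x' y' x' y'] s(2)
    unfolding 1(2) 2(2) proj_point_eq_iff[OF 1(1) 2(1)] by blast
  then have "vec.dim {conic_vec x y, conic_vec x' y'} = 2"
    using conic_vec_neq_0[OF 2(1)] by (simp add: vec.dim_insert)
  then show ?thesis unfolding s(1) 1(2) 2(2) chord_pair[OF 1(1) 2(1)] by simp
qed

lemma bij_betw_chord:
  "bij_betw chord {s :: 'a::field option set. card s = 2} hyperbolic_lines"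
  unfolding bij_betw_def
proof
  show "inj_on chord {s :: 'a option set. card s = 2}"
    using conic_point_subset_chord_iff by (intro inj_onI) blast
  show "chord ` {s :: 'a option set. card s = 2} = hyperbolic_lines"
  proof (intro subset_antisym subsetI)
    fix L assume "L \<in> chord ` {s :: 'a option set. card s = 2}"
    then obtain s :: "'a option set" where s: "card s = 2" "L = chord s" by blast
    have "card (conic_point ` s) = 2" using s(1) inj_conic_point by (metis card_image inj_on_subset subset_UNIV)
    then show "L \<in> hyperbolic_lines"
      unfolding hyperbolic_lines_def using s conic_points_of_chord[OF s(1)] dim_chord[OF s(1)]
      by (simp add: chord_def)
  next
    fix L :: "('a^3) set" assume "L \<in> hyperbolic_lines"
    then have L: "vec.subspace L" "vec.dim L = 2" and c: "card {P \<in> conic. P \<subseteq> L} = 2"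
      by (auto simp: hyperbolic_lines_def)
    obtain P Q where PQ: "{P \<in> conic. P \<subseteq> L} = {P, Q}" "P \<noteq> Q" using c by (meson card_2_iff)
    then have "P \<in> conic" "Q \<in> conic" by blast+
    then obtain \<xi> \<eta> where "P = conic_point \<xi>" "Q = conic_point \<eta>" unfolding conic_def by blast
    note PQ' = this
    have s: "card {\<xi>, \<eta>} = 2" using PQ(2) unfolding PQ' by (cases "\<xi> = \<eta>") simp_all
    have "\<Union> (conic_point ` {\<xi>, \<eta>}) \<subseteq> L" using PQ PQ' by blast
    then have "chord {\<xi>, \<eta>} \<subseteq> L" unfolding chord_def using L(1) by (rule vec.span_minimal)
    then have "chord {\<xi>, \<eta>} = L"
      using L dim_chord[OF s] by (intro vec.subspace_dim_equal) (auto simp: chord_def)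
    then show "L \<in> chord ` {s :: 'a option set. card s = 2}" using s by blast
  qed
qed

text \<open>
  The conic is the Veronese embedding of the projective line, and \<open>sym_square\<close> is
  the induced map on quadratic monomials.
\<close>
lemma plane_map_conic_vec:
  assumes "field_aut \<tau>"
  shows "plane_map A \<tau> (conic_vec x y) =
    conic_vec (A$1$1 * \<tau> x + A$1$2 * \<tau> y) (A$2$1 * \<tau> x + A$2$2 * \<tau> y)"
proof -
  have mult: "\<tau> (u * v) = \<tau> u * \<tau> v" for u v using assms by (auto simp: field_aut_def)
  show ?thesis
    by (simp add: vec_eq_iff forall_3 plane_map_def sym_square_def Let_def matrix_vector_mult_def
        sum_3 mult power2_eq_square algebra_simps)
qed

lemma plane_map_span_pair:
  assumes "field_aut \<tau>"
  shows "plane_map A \<tau> ` vec.span {u, v} = vec.span {plane_map A \<tau> u, plane_map A \<tau> v}"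
proof -
  have add: "\<tau> (x + y) = \<tau> x + \<tau> y" and mult: "\<tau> (x * y) = \<tau> x * \<tau> y" for x y
    using assms by (auto simp: field_aut_def)
  have lin: "plane_map A \<tau> (k *s u + l *s v) = \<tau> k *s plane_map A \<tau> u + \<tau> l *s plane_map A \<tau> v" for k l
    by (simp add: vec_eq_iff plane_map_def matrix_vector_mult_def add mult sum.distrib sum_distrib_left
        distrib_left mult.left_commute)
  have surj: "\<exists>k. \<tau> k = k'" for k' using assms unfolding field_aut_def by (metis bij_pointE)
  show ?thesis unfolding span_pair
  proof (intro subset_antisym subsetI)
    fix w assume "w \<in> {k *s plane_map A \<tau> u + l *s plane_map A \<tau> v | k l. True}"
    then obtain k l where "w = k *s plane_map A \<tau> u + l *s plane_map A \<tau> v" by blast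
    moreover obtain k' l' where "\<tau> k' = k" "\<tau> l' = l" using surj by blast
    ultimately have "w = plane_map A \<tau> (k' *s u + l' *s v)" by (simp add: lin)
    then show "w \<in> plane_map A \<tau> ` {k *s u + l *s v | k l. True}" by blast
  next
    fix w assume "w \<in> plane_map A \<tau> ` {k *s u + l *s v | k l. True}"
    then obtain k l where "w = plane_map A \<tau> (k *s u + l *s v)" by blast
    then show "w \<in> {k *s plane_map A \<tau> u + l *s plane_map A \<tau> v | k l. True}" unfolding lin by blast
  qed
qed

lemma plane_action_chord:
  assumes A: "det A \<noteq> 0" and \<tau>: "field_aut \<tau>" and s: "card s = 2"
  shows "plane_action (semilin_frac A \<tau>) (chord s) = chord (semilin_frac A \<tau> ` s)"
proof -
  obtain \<eta> \<zeta> where s: "s = {\<eta>, \<zeta>}" using s by (meson card_2_iff)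
  obtain x y where 1: "x \<noteq> 0 \<or> y \<noteq> 0" "\<eta> = proj_point x y" by (rule proj_point_exhaust)
  obtain x' y' where 2: "x' \<noteq> 0 \<or> y' \<noteq> 0" "\<zeta> = proj_point x' y'" by (rule proj_point_exhaust)
  have nz: "A$1$1 * \<tau> u + A$1$2 * \<tau> v \<noteq> 0 \<or> A$2$1 * \<tau> u + A$2$2 * \<tau> v \<noteq> 0" if "u \<noteq> 0 \<or> v \<noteq> 0" for u v
    by (rule linear_image_nonzero) (use A that in \<open>simp_all add: det_2 field_aut_eq_0_iff[OF \<tau>]\<close>)
  have "plane_action (semilin_frac A \<tau>) (chord s) = plane_map A \<tau> ` chord s"
    by (rule plane_action_semilin_frac[OF A \<tau>]) (simp add: chord_def)
  also have "\<dots> = chord (semilin_frac A \<tau> ` s)"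
    unfolding s 1(2) 2(2) chord_pair[OF 1(1) 2(1)] plane_map_span_pair[OF \<tau>] plane_map_conic_vec[OF \<tau>]
      image_insert image_empty semilin_frac_proj_point[OF \<tau> 1(1)] semilin_frac_proj_point[OF \<tau> 2(1)]
      chord_pair[OF nz[OF 1(1)] nz[OF 2(1)]] ..
  finally show ?thesis .
qed

section \<open>The association scheme of a transitive action\<close>

text \<open>
  Intersection numbers are constant because \<open>\<phi> g\<close> maps
  \<open>{z. (x, z) \<in> R \<and> (z, y) \<in> S}\<close> injectively into the
  corresponding set for \<open>(\<phi> g x, \<phi> g y)\<close>, and its inverse does the
  same in the other direction. Only the restriction of \<open>\<phi>\<close> to
  \<open>X\<close> has to behave like an action, since \<open>plane_action g\<close> is
  meaningful only on subspaces.
\<close>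
lemma association_scheme_orbital:
  assumes X: "finite X" "X \<noteq> {}"
    and closed: "\<And>g x. g \<in> carrier G \<Longrightarrow> x \<in> X \<Longrightarrow> \<phi> g x \<in> X"
    and unit: "\<exists>g\<in>carrier G. \<forall>x\<in>X. \<phi> g x = x"
    and comp: "\<And>g g'. g \<in> carrier G \<Longrightarrow> g' \<in> carrier G \<Longrightarrow> \<exists>k\<in>carrier G. \<forall>x\<in>X. \<phi> k x = \<phi> g (\<phi> g' x)"
    and inv: "\<And>g. g \<in> carrier G \<Longrightarrow> \<exists>k\<in>carrier G. \<forall>x\<in>X. \<phi> k (\<phi> g x) = x"
    and trans: "\<And>x y. x \<in> X \<Longrightarrow> y \<in> X \<Longrightarrow> \<exists>g\<in>carrier G. \<phi> g x = y"
  shows "association_scheme X (orbital_scheme G X \<phi>)"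
proof -
  define Orb where "Orb x y = {(\<phi> g x, \<phi> g y) | g. g \<in> carrier G}" for x y
  have Rs: "orbital_scheme G X \<phi> = {Orb x y | x y. x \<in> X \<and> y \<in> X}"
    by (auto simp: orbital_scheme_def orbits_def orbit_def Orb_def)
  have self: "(x, y) \<in> Orb x y" if "x \<in> X" "y \<in> X" for x y
  proof -
    obtain g where "g \<in> carrier G" "\<forall>z\<in>X. \<phi> g z = z" using unit by blast
    with that have "(x, y) = (\<phi> g x, \<phi> g y)" by simp
    with \<open>g \<in> carrier G\<close> show ?thesis unfolding Orb_def by blast
  qed
  have sub: "Orb (\<phi> g x) (\<phi> g y) \<subseteq> Orb x y" if a: "g \<in> carrier G" "x \<in> X" "y \<in> X" for g x y
  proof
    fix z assume "z \<in> Orb (\<phi> g x) (\<phi> g y)"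
    then obtain g' where g': "g' \<in> carrier G" "z = (\<phi> g' (\<phi> g x), \<phi> g' (\<phi> g y))" by (auto simp: Orb_def)
    obtain k where "k \<in> carrier G" "\<forall>x\<in>X. \<phi> k x = \<phi> g' (\<phi> g x)" using comp[OF g'(1) a(1)] by blast
    with g' a have "z = (\<phi> k x, \<phi> k y)" by simp
    with \<open>k \<in> carrier G\<close> show "z \<in> Orb x y" unfolding Orb_def by blast
  qed
  have eq: "Orb u v = Orb x y" if a: "(u, v) \<in> Orb x y" "x \<in> X" "y \<in> X" for u v x y
  proof -
    obtain g where g: "g \<in> carrier G" "u = \<phi> g x" "v = \<phi> g y" using a(1) by (auto simp: Orb_def)
    obtain k where k: "k \<in> carrier G" "\<forall>x\<in>X. \<phi> k (\<phi> g x) = x" using inv[OF g(1)] by blast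
    then have "Orb x y \<subseteq> Orb u v"
      using sub[OF k(1), of u v] closed[OF g(1)] a(2,3) g(2,3) by simp
    with sub[OF g(1) a(2,3)] g(2,3) show ?thesis by simp
  qed
  have mem: "(\<phi> g x, \<phi> g y) \<in> R" if a: "R \<in> orbital_scheme G X \<phi>" "(x, y) \<in> R" "g \<in> carrier G" for R x y g
  proof -
    obtain u v where R: "R = Orb u v" "u \<in> X" "v \<in> X" using a(1) Rs by blast
    then have "R = Orb x y" using eq a(2) by blast
    then show ?thesis using a(3) unfolding Orb_def by blast
  qed
  have RX: "R \<subseteq> X \<times> X" if "R \<in> orbital_scheme G X \<phi>" for R
    using that closed unfolding Rs Orb_def by blast
  have part: "partition_on (X \<times> X) (orbital_scheme G X \<phi>)"
  proof (rule partition_onI)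
    show "\<Union> (orbital_scheme G X \<phi>) = X \<times> X"
      using RX self unfolding Rs by blast
    show "disjnt R R'" if a: "R \<in> orbital_scheme G X \<phi>" "R' \<in> orbital_scheme G X \<phi>" "R \<noteq> R'" for R R'
    proof (rule ccontr)
      assume "\<not> disjnt R R'"
      then obtain u v where "(u, v) \<in> R" "(u, v) \<in> R'" unfolding disjnt_def by auto
      moreover obtain x y x' y' where "R = Orb x y" "R' = Orb x' y'" "x \<in> X" "y \<in> X" "x' \<in> X" "y' \<in> X"
        using a unfolding Rs by blast
      ultimately have "R = R'" using eq by metis
      then show False using a by blast
    qed
    show "{} \<notin> orbital_scheme G X \<phi>" using self unfolding Rs by blast
  qed
  have diag: "Id_on X \<in> orbital_scheme G X \<phi>"
  proof -
    obtain x where x: "x \<in> X" using X by blast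
    have "Orb x x = Id_on X"
      using trans[OF x] closed[OF _ x] unfolding Orb_def Id_on_def by blast
    then show ?thesis using x unfolding Rs by blast
  qed
  have conv: "R\<inverse> \<in> orbital_scheme G X \<phi>" if a: "R \<in> orbital_scheme G X \<phi>" for R
  proof -
    obtain x y where "R = Orb x y" "x \<in> X" "y \<in> X" using a unfolding Rs by blast
    moreover have "(Orb x y)\<inverse> = Orb y x" by (auto simp: Orb_def)
    ultimately show ?thesis unfolding Rs by blast
  qed
  have "\<exists>n. \<forall>(x, y)\<in>T. card {z \<in> X. (x, z) \<in> R \<and> (z, y) \<in> S} = n"
    if R: "R \<in> orbital_scheme G X \<phi>" and S: "S \<in> orbital_scheme G X \<phi>" and T: "T \<in> orbital_scheme G X \<phi>" for R S T
  proof -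
    define N where "N x y = {z \<in> X. (x, z) \<in> R \<and> (z, y) \<in> S}" for x y
    have le: "card (N x y) \<le> card (N (\<phi> g x) (\<phi> g y))" if g: "g \<in> carrier G" for g x y
    proof (rule card_inj_on_le)
      show "inj_on (\<phi> g) (N x y)"
      proof -
        obtain k where "\<forall>z\<in>X. \<phi> k (\<phi> g z) = z" using inv[OF g] by blast
        then show ?thesis by (intro inj_on_inverseI[of _ "\<phi> k"]) (simp add: N_def)
      qed
      show "\<phi> g ` N x y \<subseteq> N (\<phi> g x) (\<phi> g y)"
        using mem[OF R _ g] mem[OF S _ g] closed[OF g] unfolding N_def by blast
      show "finite (N (\<phi> g x) (\<phi> g y))" using X by (simp add: N_def)
    qed
    obtain a b where ab: "T = Orb a b" "a \<in> X" "b \<in> X" using T unfolding Rs by blast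
    have "card (N x y) = card (N a b)" if "(x, y) \<in> T" for x y
    proof -
      obtain g where g: "g \<in> carrier G" "x = \<phi> g a" "y = \<phi> g b" using \<open>(x, y) \<in> T\<close> ab by (auto simp: Orb_def)
      obtain k where k: "k \<in> carrier G" "\<forall>x\<in>X. \<phi> k (\<phi> g x) = x" using inv[OF g(1)] by blast
      then have "\<phi> k x = a" "\<phi> k y = b" using g ab by simp_all
      then show ?thesis using le[OF g(1), of a b] le[OF k(1), of x y] g by simp
    qed
    then show ?thesis unfolding N_def by blast
  qed
  then show ?thesis
    unfolding association_scheme_def using X part diag conv by blast
qed

context square_order_field
begin

section \<open>Orbitals on hyperbolic lines\<close>

lemma plane_action_M:
  assumes "g \<in> M_perms" "card (s :: 'a option set) = 2" shows "plane_action g (chord s) = chord (g ` s)"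
proof -
  obtain a b c d where e: "a * d - b * c \<noteq> 0" and g: "g = twisted_frac a b c d"
    using assms(1) by (auto simp: M_perms_eq)
  show ?thesis unfolding g twisted_frac_def
    by (rule plane_action_chord[OF _ field_aut_twist assms(2)]) (use e in \<open>simp add: det_2\<close>)
qed

lemma card_image_M: "g \<in> M_perms \<Longrightarrow> card (g ` s) = card (s :: 'a option set)"
  using bij_M by (metis bij_is_inj card_image inj_on_subset subset_UNIV)

lemma carrier_M_group [simp]: "carrier M_group = M_perms"
  by (simp add: M_group_def)

lemma M_to_zero_infinity:
  assumes "card (s :: 'a option set) = 2" shows "\<exists>g\<in>M_perms. g ` s = {None, Some 0}"
proof -
  obtain \<xi> \<eta> where s: "s = {\<xi>, \<eta>}" "\<xi> \<noteq> \<eta>" using assms by (meson card_2_iff)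
  have "\<not> {None, Some 0, Some (1::'a)} \<subseteq> s"
  proof
    assume "{None, Some 0, Some (1::'a)} \<subseteq> s"
    then have "card {None, Some 0, Some (1::'a)} \<le> card s" by (intro card_mono) auto
    with assms show False by simp
  qed
  then obtain \<zeta> where "\<zeta> \<notin> s" by blast
  then have "distinct [\<xi>, \<eta>, \<zeta>]" using s by auto
  then obtain g where "g \<in> M_perms" "g \<xi> = None" "g \<eta> = Some 0" by (rule three_transitive)
  then show ?thesis using s by (intro bexI[of _ g]) auto
qed

lemma transitive_M_pairs:
  assumes "card (s :: 'a option set) = 2" "card t = 2" shows "\<exists>g\<in>M_perms. g ` s = t"
proof -
  obtain g where g: "g \<in> M_perms" "g ` s = {None, Some 0}" using M_to_zero_infinity[OF assms(1)] by blast
  obtain g' where g': "g' \<in> M_perms" "g' ` t = {None, Some 0}" using M_to_zero_infinity[OF assms(2)] by blast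
  obtain k where k: "k \<in> M_perms" "k \<circ> g' = id" using inverse_in_M[OF g'(1)] by blast
  have "(k \<circ> g) ` s = k ` g ` s" by (rule image_comp[symmetric])
  also have "\<dots> = k ` g' ` t" by (simp only: g g')
  also have "\<dots> = t" unfolding image_comp k(2) by simp
  finally show ?thesis using comp_in_M[OF k(1) g(1)] by blast
qed

lemma association_scheme_M: "association_scheme (hyperbolic_lines :: ('a^3) set set) M_scheme"
  unfolding M_scheme_def
proof (rule association_scheme_orbital; (simp only: carrier_M_group)?)
  have L: "\<exists>s. card s = 2 \<and> L = chord s" if "L \<in> hyperbolic_lines" for L :: "('a^3) set"
    using that bij_betw_chord[where ?'a='a] unfolding bij_betw_def by blast
  have L': "chord s \<in> hyperbolic_lines" if "card s = 2" for s :: "'a option set"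
    using that bij_betw_chord[where ?'a='a] unfolding bij_betw_def by blast
  show "finite (hyperbolic_lines :: ('a^3) set set)" by simp
  show "hyperbolic_lines \<noteq> ({} :: ('a^3) set set)" using L'[of "{None, Some 0}"] by auto
  show "plane_action g L \<in> hyperbolic_lines" if "g \<in> M_perms" "L \<in> hyperbolic_lines" for g and L :: "('a^3) set"
  proof -
    from L[OF that(2)] obtain s where "card s = 2" "L = chord s" by blast
    then show ?thesis using plane_action_M[OF that(1)] L' card_image_M[OF that(1)] by simp
  qed
  show "\<exists>g\<in>M_perms. \<forall>L\<in>(hyperbolic_lines :: ('a^3) set set). plane_action g L = L"
  proof (intro bexI[OF _ id_in_M] ballI)
    fix L :: "('a^3) set" assume "L \<in> hyperbolic_lines"
    from L[OF this] obtain s where "card s = 2" "L = chord s" by blast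
    then show "plane_action id L = L" using plane_action_M[OF id_in_M] by simp
  qed
  show "\<exists>k\<in>M_perms. \<forall>L\<in>(hyperbolic_lines :: ('a^3) set set). plane_action k L = plane_action g (plane_action g' L)"
    if g: "g \<in> M_perms" "g' \<in> M_perms" for g g' :: "'a option \<Rightarrow> 'a option"
  proof (intro bexI[OF _ comp_in_M[OF g]] ballI)
    fix L :: "('a^3) set" assume "L \<in> hyperbolic_lines"
    from L[OF this] obtain s where "card s = 2" "L = chord s" by blast
    then show "plane_action (g \<circ> g') L = plane_action g (plane_action g' L)"
      using plane_action_M[OF comp_in_M[OF g]] plane_action_M[OF g(1)] plane_action_M[OF g(2)] card_image_M[OF g(2)]
      by (simp add: image_comp)
  qed
  show "\<exists>k\<in>M_perms. \<forall>L\<in>(hyperbolic_lines :: ('a^3) set set). plane_action k (plane_action g L) = L"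
    if g: "g \<in> M_perms" for g :: "'a option \<Rightarrow> 'a option"
  proof -
    obtain k where k: "k \<in> M_perms" "k \<circ> g = id" using inverse_in_M[OF g] by blast
    have "plane_action k (plane_action g L) = L" if "L \<in> hyperbolic_lines" for L :: "('a^3) set"
    proof -
      from L[OF that] obtain s where "card s = 2" "L = chord s" by blast
      then show ?thesis
        using plane_action_M[OF g] plane_action_M[OF k(1)] card_image_M[OF g] k(2) by (simp add: image_comp)
    qed
    then show ?thesis using k(1) by blast
  qed
  show "\<exists>g\<in>M_perms. plane_action g L = L'" if "L \<in> hyperbolic_lines" "L' \<in> hyperbolic_lines" for L L' :: "('a^3) set"
  proof -
    from L[OF that(1)] obtain s where s: "card s = 2" "L = chord s" by blast
    from L[OF that(2)] obtain t where t: "card t = 2" "L' = chord t" by blast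
    obtain g where "g \<in> M_perms" "g ` s = t" using transitive_M_pairs[OF s(1) t(1)] by blast
    then show ?thesis using plane_action_M s t by (intro bexI[of _ g]) auto
  qed
qed

text \<open>
  The orbit of a pair of hyperbolic lines, in terms of the pairs of conic points which span
  them.
\<close>
definition orbital :: "'a option set \<Rightarrow> 'a option set \<Rightarrow> ('a^3) set rel" where
  "orbital s t = {(chord (g ` s), chord (g ` t)) | g. g \<in> M_perms}"

lemma M_scheme_eq: "M_scheme = {orbital s t | s t. card s = 2 \<and> card t = 2}"
proof -
  let ?orb = "\<lambda>s t. orbit M_group (\<lambda>g. map_prod (plane_action g) (plane_action g)) (chord s, chord (t :: 'a option set))"
  have orb: "?orb s t = orbital s t" if st: "card s = 2" "card t = 2" for s t
  proof -
    have "(plane_action g (chord s), plane_action g (chord t)) = (chord (g ` s), chord (g ` t))"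
      if "g \<in> M_perms" for g using plane_action_M[OF that] st by simp
    then show ?thesis unfolding orbit_def orbital_def carrier_M_group map_prod_simp by blast
  qed
  have L: "(hyperbolic_lines :: ('a^3) set set) = chord ` {s. card s = 2}"
    using bij_betw_chord unfolding bij_betw_def by blast
  have "M_scheme = {?orb s t | s t. card s = 2 \<and> card t = 2}"
    unfolding M_scheme_def orbital_scheme_def orbits_def L by blast
  also have "\<dots> = {orbital s t | s t. card s = 2 \<and> card t = 2}" using orb by blast
  finally show ?thesis .
qed

lemma chord_eq_iff: "card s = 2 \<Longrightarrow> card t = 2 \<Longrightarrow> chord s = chord t \<longleftrightarrow> s = (t :: 'a option set)"
  using bij_betw_chord[where ?'a='a] unfolding bij_betw_def inj_on_def by blast

lemma in_orbital_iff:
  assumes "card s = 2" "card t = 2" "card s' = 2" "card t' = 2"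
  shows "(chord s', chord t') \<in> orbital s t \<longleftrightarrow> (\<exists>g\<in>M_perms. g ` s = s' \<and> g ` t = t')"
proof
  assume "(chord s', chord t') \<in> orbital s t"
  then obtain g where g: "g \<in> M_perms" "chord s' = chord (g ` s)" "chord t' = chord (g ` t)" by (auto simp: orbital_def)
  then have "s' = g ` s" "t' = g ` t" using assms card_image_M[OF g(1)] by (simp_all add: chord_eq_iff)
  with g(1) show "\<exists>g\<in>M_perms. g ` s = s' \<and> g ` t = t'" by blast
qed (auto simp: orbital_def)

lemma orbital_image: assumes "g \<in> M_perms" shows "orbital (g ` s) (g ` t) = orbital s t"
proof -
  have sub: "orbital (g ` s) (g ` t) \<subseteq> orbital s t" if "g \<in> M_perms" for g s t
    using comp_in_M[OF _ that] unfolding orbital_def image_comp by blast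
  obtain k where k: "k \<in> M_perms" "k \<circ> g = id" using inverse_in_M[OF assms] by blast
  have "orbital (k ` g ` s) (k ` g ` t) \<subseteq> orbital (g ` s) (g ` t)" by (rule sub[OF k(1)])
  then have "orbital s t \<subseteq> orbital (g ` s) (g ` t)" unfolding image_comp k(2) by simp
  with sub[OF assms] show ?thesis by blast
qed

lemma orbital_self: "(chord s, chord t) \<in> orbital s t"
  unfolding orbital_def by (rule CollectI) (rule exI[of _ id], simp add: id_in_M)

lemma orbital_eq_iff:
  assumes "card s = 2" "card t = 2" "card s' = 2" "card t' = 2"
  shows "orbital s t = orbital s' t' \<longleftrightarrow> (\<exists>g\<in>M_perms. g ` s = s' \<and> g ` t = t')"
proof
  assume "orbital s t = orbital s' t'"
  then have "(chord s', chord t') \<in> orbital s t" using orbital_self by simp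
  then show "\<exists>g\<in>M_perms. g ` s = s' \<and> g ` t = t'" unfolding in_orbital_iff[OF assms] .
next
  assume "\<exists>g\<in>M_perms. g ` s = s' \<and> g ` t = t'"
  then obtain g where g: "g \<in> M_perms" "g ` s = s'" "g ` t = t'" by blast
  show "orbital s t = orbital s' t'" using orbital_image[OF g(1), of s t] unfolding g(2,3) by (rule sym)
qed

lemma orbital_converse: "(orbital s t)\<inverse> = orbital t s"
  by (auto simp: orbital_def)

text \<open>
  This separates the diagonal, the meeting pairs and the disjoint pairs.
\<close>
lemma orbital_eq_cards:
  assumes "card s = 2" "card t = 2" "card s' = 2" "card t' = 2" "orbital s t = orbital s' t'"
  shows "card (s \<inter> t) = card (s' \<inter> t')"
proof -
  obtain g where g: "g \<in> M_perms" "g ` s = s'" "g ` t = t'"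
    using assms(5) unfolding orbital_eq_iff[OF assms(1-4)] by blast
  have "s' \<inter> t' = g ` (s \<inter> t)" using g bij_M[OF g(1)] by (simp add: bij_is_inj image_Int)
  then show ?thesis by (simp add: card_image_M[OF g(1)])
qed

abbreviation base :: "'a option set" where "base \<equiv> {None, Some 0}"

definition equal_orbital :: "('a^3) set rel" where "equal_orbital = orbital base base"
definition meeting_orbital :: "('a^3) set rel" where "meeting_orbital = orbital base {None, Some 1}"
definition ratio_orbital :: "'a \<Rightarrow> ('a^3) set rel" where "ratio_orbital k = orbital base {Some 1, Some k}"

lemma equal_orbital_eq: "equal_orbital = Id_on hyperbolic_lines"
proof -
  have "equal_orbital = {(chord (g ` base), chord (g ` base)) | g. g \<in> M_perms}"
    by (simp add: equal_orbital_def orbital_def)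
  also have "\<dots> = Id_on (chord ` {s. card s = 2})"
  proof (intro subset_antisym subsetI)
    fix z assume "z \<in> Id_on (chord ` {s :: 'a option set. card s = 2})"
    then obtain s :: "'a option set" where s: "card s = 2" "z = (chord s, chord s)" by (auto simp: Id_on_def)
    have "\<exists>g\<in>M_perms. g ` base = s" by (rule transitive_M_pairs) (use s in simp_all)
    with s show "z \<in> {(chord (g ` base), chord (g ` base)) | g. g \<in> M_perms}" by blast
  next
    fix z assume "z \<in> {(chord (g ` base), chord (g ` base)) | g. g \<in> M_perms}"
    then obtain g where "g \<in> M_perms" "z = (chord (g ` base), chord (g ` base))" by blast
    moreover from this have "card (g ` base) = 2" by (simp add: card_image_M del: image_insert)
    ultimately show "z \<in> Id_on (chord ` {s :: 'a option set. card s = 2})" by (auto simp: Id_on_def)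
  qed
  also have "chord ` {s :: 'a option set. card s = 2} = hyperbolic_lines"
    using bij_betw_chord unfolding bij_betw_def by blast
  finally show ?thesis .
qed

lemma orbital_meeting:
  assumes "distinct [\<alpha>, \<beta>, \<gamma>]" shows "orbital {\<alpha>, \<beta>} {\<alpha>, \<gamma>} = meeting_orbital"
proof -
  obtain g where "g \<in> M_perms" "g \<alpha> = None" "g \<beta> = Some 0" "g \<gamma> = Some 1" using three_transitive[OF assms] .
  then show ?thesis using orbital_image[of g "{\<alpha>, \<beta>}" "{\<alpha>, \<gamma>}"] by (simp add: meeting_orbital_def)
qed

text \<open>
  By 3-transitivity, three of the at most four points involved can be put in the positions
  \<open>\<infinity>\<close>, \<open>0\<close>, \<open>1\<close>.
\<close>
lemma orbital_cases:
  assumes "card s = 2" "card t = 2"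
  shows "orbital s t = equal_orbital \<and> s = t \<or> orbital s t = meeting_orbital \<or>
    (\<exists>k. k \<noteq> 0 \<and> k \<noteq> 1 \<and> orbital s t = ratio_orbital k)"
proof -
  obtain \<xi> \<eta> where s: "s = {\<xi>, \<eta>}" "\<xi> \<noteq> \<eta>" using assms(1) by (meson card_2_iff)
  obtain \<zeta> \<theta> where t: "t = {\<zeta>, \<theta>}" "\<zeta> \<noteq> \<theta>" using assms(2) by (meson card_2_iff)
  consider "s = t" | \<alpha> \<beta> \<gamma> where "s = {\<alpha>, \<beta>}" "t = {\<alpha>, \<gamma>}" "distinct [\<alpha>, \<beta>, \<gamma>]" | "distinct [\<xi>, \<eta>, \<zeta>, \<theta>]"
  proof -
    have "\<exists>\<alpha> \<beta> \<gamma>. s = {\<alpha>, \<beta>} \<and> t = {\<alpha>, \<gamma>} \<and> distinct [\<alpha>, \<beta>, \<gamma>]" if a: "s \<noteq> t" "\<not> distinct [\<xi>, \<eta>, \<zeta>, \<theta>]"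
    proof -
      consider "\<zeta> = \<xi>" | "\<zeta> = \<eta>" | "\<theta> = \<xi>" | "\<theta> = \<eta>" using a(2) s t by auto
      then show ?thesis
      proof cases
        case 1
        with s t a(1) have "s = {\<xi>, \<eta>}" "t = {\<xi>, \<theta>}" "distinct [\<xi>, \<eta>, \<theta>]" by auto
        then show ?thesis by blast
      next
        case 2
        with s t a(1) have "s = {\<eta>, \<xi>}" "t = {\<eta>, \<theta>}" "distinct [\<eta>, \<xi>, \<theta>]" by auto
        then show ?thesis by blast
      next
        case 3
        with s t a(1) have "s = {\<xi>, \<eta>}" "t = {\<xi>, \<zeta>}" "distinct [\<xi>, \<eta>, \<zeta>]" by auto
        then show ?thesis by blast
      next
        case 4
        with s t a(1) have "s = {\<eta>, \<xi>}" "t = {\<eta>, \<zeta>}" "distinct [\<eta>, \<xi>, \<zeta>]" by auto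
        then show ?thesis by blast
      qed
    qed
    then show thesis using that by blast
  qed
  then show ?thesis
  proof cases
    case 1
    obtain g where g: "g \<in> M_perms" "g ` s = base" using M_to_zero_infinity[OF assms(1)] by blast
    have "orbital s t = equal_orbital"
      using orbital_image[OF g(1), of s s] 1 unfolding g(2) equal_orbital_def by simp
    with 1 show ?thesis by simp
  next
    case 2
    then show ?thesis using orbital_meeting by simp
  next
    case 3
    then have "distinct [\<xi>, \<eta>, \<zeta>]" by simp
    then obtain g where g: "g \<in> M_perms" "g \<xi> = None" "g \<eta> = Some 0" "g \<zeta> = Some 1" using three_transitive by blast
    have inj: "inj g" using bij_M[OF g(1)] by (rule bij_is_inj)
    have "g \<theta> \<noteq> g \<xi>" "g \<theta> \<noteq> g \<eta>" "g \<theta> \<noteq> g \<zeta>" using 3 by (auto simp: inj_eq[OF inj])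
    then obtain k where k: "g \<theta> = Some k" "k \<noteq> 0" "k \<noteq> 1" using g by (cases "g \<theta>") auto
    have "orbital s t = ratio_orbital k"
      using orbital_image[OF g(1), of s t] by (simp add: s(1) t(1) g k ratio_orbital_def)
    with k show ?thesis by blast
  qed
qed

lemma orbital_in_M_scheme: "card s = 2 \<Longrightarrow> card t = 2 \<Longrightarrow> orbital s t \<in> M_scheme"
  unfolding M_scheme_eq by blast

lemma M_scheme_cases:
  "M_scheme = {equal_orbital, meeting_orbital} \<union> ratio_orbital ` (UNIV - {0, 1})"
proof (intro subset_antisym subsetI)
  fix R :: "('a^3) set rel" assume "R \<in> M_scheme"
  then obtain s t where st: "card s = 2" "card t = 2" "R = orbital s t" unfolding M_scheme_eq by blast
  show "R \<in> {equal_orbital, meeting_orbital} \<union> ratio_orbital ` (UNIV - {0, 1})"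
    using orbital_cases[OF st(1,2)] unfolding st(3)[symmetric] by blast
next
  have c: "card base = 2" "card {None, Some (1::'a)} = 2" by simp_all
  fix R assume "R \<in> {equal_orbital, meeting_orbital} \<union> ratio_orbital ` (UNIV - {0, 1})"
  then consider "R = orbital base base" | "R = orbital base {None, Some 1}"
    | k where "k \<noteq> 1" "R = orbital base {Some 1, Some k}"
    by (auto simp: equal_orbital_def meeting_orbital_def ratio_orbital_def)
  then show "R \<in> M_scheme"
  proof cases
    case 1
    with orbital_in_M_scheme[OF c(1) c(1)] show ?thesis by simp
  next
    case 2
    with orbital_in_M_scheme[OF c(1) c(2)] show ?thesis by simp
  next
    case (3 k)
    then have "card {Some 1, Some k} = 2" by simp
    from orbital_in_M_scheme[OF c(1) this] 3 show ?thesis by simp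
  qed
qed


section \<open>Counting the classes\<close>

lemma twisted_frac_apply:
  fixes a b c d :: 'a
  defines "t \<equiv> twist (a * d - b * c)"
  shows "twisted_frac a b c d None = (if c = 0 then None else Some (a / c))"
    and "twisted_frac a b c d (Some x) =
      (if c * t x + d = 0 then None else Some ((a * t x + b) / (c * t x + d)))"
  by (simp_all add: twisted_frac_def semilin_frac_def t_def)

lemma is_square_divide_iff: "x \<noteq> 0 \<Longrightarrow> y \<noteq> 0 \<Longrightarrow> is_square (x / y) \<longleftrightarrow> is_square (x * (y::'a))"
  by (simp add: divide_inverse is_square_mult_iff is_square_inverse_iff)

lemma twist_cong: "(is_square x \<longleftrightarrow> is_square y) \<Longrightarrow> twist x = twist y"
  by (simp add: twist_def)

text \<open>
  The stabilizer of \<open>{\<infinity>, 0}\<close>: the matrix is diagonal or antidiagonal,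
  and its determinant has the quadratic character of \<open>m\<close> (for antidiagonal
  matrices because \<open>-1\<close> is a square).
\<close>
lemma M_fixing_base:
  assumes g: "g \<in> M_perms" "g ` base = base"
  shows "\<exists>m. m \<noteq> 0 \<and> ((\<forall>x. x \<noteq> 0 \<longrightarrow> g (Some x) = Some (m * twist m x)) \<or>
    (\<forall>x. x \<noteq> 0 \<longrightarrow> g (Some x) = Some (m / twist m x)))"
proof -
  obtain a b c d where e: "a * d - b * c \<noteq> 0" and g': "g = twisted_frac a b c d"
    using g(1) by (auto simp: M_perms_eq)
  have "g None = None \<and> g (Some 0) = Some 0 \<or> g None = Some 0 \<and> g (Some 0) = None"
    using g(2) by (auto simp: doubleton_eq_iff)
  then consider "b = 0" "c = 0" "a \<noteq> 0" "d \<noteq> 0" | "a = 0" "d = 0" "b \<noteq> 0" "c \<noteq> 0"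
    using e by (auto simp: g' twisted_frac_apply split: if_splits)
  then show ?thesis
  proof cases
    case 1
    have "twist (a / d) = twist (a * d)" using 1 by (intro twist_cong is_square_divide_iff)
    then have "g (Some x) = Some (a / d * twist (a / d) x)" for x
      unfolding g' using 1 by (simp add: twisted_frac_apply)
    then show ?thesis using 1 by (intro exI[of _ "a / d"]) simp
  next
    case 2
    have "twist (b / c) = twist (- (b * c))"
      unfolding twist_def is_square_minus_iff using is_square_divide_iff[OF 2(3,4)] by simp
    then have "g (Some x) = Some (b / c / twist (b / c) x)" if "x \<noteq> 0" for x
      unfolding g' using 2 that by (simp add: twisted_frac_apply)
    then show ?thesis using 2 by (intro exI[of _ "b / c"]) simp
  qed
qed

lemma scaling_in_M:
  assumes "m \<noteq> 0"
  shows "\<exists>g\<in>M_perms. g None = None \<and> g (Some 0) = Some 0 \<and> (\<forall>x. g (Some x) = Some (m * twist m x))"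
proof (rule bexI)
  show "twisted_frac m 0 0 1 \<in> M_perms" using assms by (intro twisted_frac_in_M) simp
qed (simp add: twisted_frac_apply)

lemma inversion_in_M:
  "\<exists>g\<in>M_perms. g None = Some 0 \<and> g (Some 0) = None \<and> (\<forall>x::'a. x \<noteq> 0 \<longrightarrow> g (Some x) = Some (inverse x))"
proof (rule bexI)
  show "twisted_frac 0 1 1 0 \<in> M_perms" by (intro twisted_frac_in_M) simp
qed (simp add: twisted_frac_apply twist_def is_square_minus_one divide_inverse)

text \<open>
  The ratios equivalent to \<open>k\<close>, that is, the orbit of \<open>k\<close> under
  interchanging the two points of either 2-subset.
\<close>
definition ratio_class :: "'a \<Rightarrow> 'a set" where
  "ratio_class k = (if is_square k then {k, inverse k} else {k, inverse k, \<sigma> k, inverse (\<sigma> k)})"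

lemma ratio_orbital_inverse: "k \<noteq> 0 \<Longrightarrow> ratio_orbital (inverse k) = ratio_orbital k"
proof -
  assume k: "k \<noteq> 0"
  obtain g :: "'a option \<Rightarrow> 'a option" where g: "g \<in> M_perms" "g None = Some 0" "g (Some 0) = None" "\<forall>x. x \<noteq> 0 \<longrightarrow> g (Some x) = Some (inverse x)"
    using inversion_in_M by blast
  show ?thesis
    using orbital_image[OF g(1), of base "{Some 1, Some k}"] k
    by (simp add: g ratio_orbital_def insert_commute)
qed

text \<open>
  Multiplying by \<open>m = 1 / \<sigma> k\<close>, a nonsquare, is accompanied by
  \<open>\<sigma>\<close>; it moves \<open>k\<close> to \<open>1\<close> and \<open>1\<close>
  to \<open>m\<close>.
\<close>
lemma ratio_orbital_\<sigma>:
  assumes "\<not> is_square k" shows "ratio_orbital (\<sigma> k) = ratio_orbital k"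
proof -
  have k: "k \<noteq> 0" using assms by auto
  let ?m = "inverse (\<sigma> k)"
  have m: "?m \<noteq> 0" using k by (simp add: \<sigma>_eq_0_iff)
  have t: "twist ?m = \<sigma>" using assms by (simp add: twist_def is_square_inverse_iff is_square_\<sigma>_iff)
  obtain g where g: "g \<in> M_perms" "g None = None" "g (Some 0) = Some 0" "\<forall>x. g (Some x) = Some (?m * twist ?m x)"
    using scaling_in_M[OF m] by blast
  have "ratio_orbital ?m = ratio_orbital k"
    using orbital_image[OF g(1), of base "{Some 1, Some k}"] m
    by (simp add: g t \<sigma>_0 \<sigma>_1 ratio_orbital_def insert_commute \<sigma>_eq_0_iff k)
  then show ?thesis using ratio_orbital_inverse[of "\<sigma> k"] k by (simp add: \<sigma>_eq_0_iff)
qed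

text \<open>
  An element of the stabilizer with parameter \<open>m\<close> sends \<open>1\<close> to
  \<open>m\<close>. If \<open>m = 1\<close>, it is not twisted and \<open>k'\<close> is
  \<open>k\<close> or its inverse. Otherwise \<open>m = k'\<close>, so the quadratic
  character of \<open>k'\<close> decides whether \<open>\<sigma>\<close> is applied.
\<close>
lemma ratio_orbital_eq_iff:
  assumes k: "k \<noteq> 0" "k \<noteq> 1" and k': "k' \<noteq> 0" "k' \<noteq> 1"
  shows "ratio_orbital k = ratio_orbital k' \<longleftrightarrow> k' \<in> ratio_class k"
proof
  assume "ratio_orbital k = ratio_orbital k'"
  then have "\<exists>g\<in>M_perms. g ` base = base \<and> g ` {Some 1, Some k} = {Some 1, Some k'}"
    unfolding ratio_orbital_def by (subst (asm) orbital_eq_iff) (use k k' in auto)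
  then obtain g where g: "g \<in> M_perms" "g ` base = base" "g ` {Some 1, Some k} = {Some 1, Some k'}" by blast
  obtain m where m: "m \<noteq> 0" "(\<forall>x. x \<noteq> 0 \<longrightarrow> g (Some x) = Some (m * twist m x)) \<or>
    (\<forall>x. x \<noteq> 0 \<longrightarrow> g (Some x) = Some (m / twist m x))"
    using M_fixing_base[OF g(1,2)] by blast
  \<comment> \<open>Passing to the inverse of \<open>k\<close> treats \<open>x \<mapsto> m / x\<close> like \<open>x \<mapsto> m x\<close>.\<close>
  have "\<exists>w. (w = k \<or> w = inverse k) \<and> g (Some 1) = Some m \<and> g (Some k) = Some (m * twist m w)"
    using m(2)
  proof
    assume "\<forall>x. x \<noteq> 0 \<longrightarrow> g (Some x) = Some (m * twist m x)"
    then show ?thesis using k by (intro exI[of _ k]) simp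
  next
    assume "\<forall>x. x \<noteq> 0 \<longrightarrow> g (Some x) = Some (m / twist m x)"
    then show ?thesis using k by (intro exI[of _ "inverse k"]) (simp add: divide_inverse)
  qed
  then obtain w where w: "w = k \<or> w = inverse k" "g (Some 1) = Some m" "g (Some k) = Some (m * twist m w)" by blast
  have sq: "is_square w \<longleftrightarrow> is_square k" using w(1) by (auto simp: is_square_inverse_iff)
  have "{Some m, Some (m * twist m w)} = {Some 1, Some k'}" using g(3) by (simp add: w)
  then consider "m = 1" "twist m w = k'" | "m = k'" "m * twist m w = 1"
    by (auto simp: doubleton_eq_iff)
  then show "k' \<in> ratio_class k"
  proof cases
    case 1
    then have "w = k'" by (simp add: twist_def)
    with w(1) show ?thesis by (auto simp: ratio_class_def)
  next
    case 2
    then have inv: "k' = inverse (twist k' w)" by (metis inverse_inverse_eq inverse_unique mult.commute)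
    then have "is_square k' \<longleftrightarrow> is_square (inverse (twist k' w))" by (rule arg_cong)
    then have "is_square k' \<longleftrightarrow> is_square k" by (simp only: is_square_inverse_iff is_square_twist_iff sq)
    with inv w(1) show ?thesis by (auto simp: ratio_class_def twist_def \<sigma>_inverse split: if_splits)
  qed
next
  assume "k' \<in> ratio_class k"
  then consider "k' = k" | "k' = inverse k" | "\<not> is_square k" "k' = \<sigma> k" | "\<not> is_square k" "k' = inverse (\<sigma> k)"
    by (auto simp: ratio_class_def split: if_splits)
  then show "ratio_orbital k = ratio_orbital k'"
  proof cases
    case 4
    then show ?thesis using ratio_orbital_inverse[of "\<sigma> k"] ratio_orbital_\<sigma>[of k] k by (simp add: \<sigma>_eq_0_iff)
  qed (use ratio_orbital_inverse k ratio_orbital_\<sigma> in simp_all)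
qed

lemma distinct_orbitals:
  assumes "k \<noteq> 0" "k \<noteq> 1"
  shows "equal_orbital \<noteq> meeting_orbital" "ratio_orbital k \<noteq> equal_orbital" "ratio_orbital k \<noteq> meeting_orbital"
proof -
  have c: "card base = 2" "card {None, Some (1::'a)} = 2" "card {Some 1, Some k} = 2" using assms by simp_all
  have i: "card (base \<inter> base) = 2" "card (base \<inter> {None, Some 1}) = 1" "card (base \<inter> {Some 1, Some k}) = 0"
    using assms by simp_all
  show "equal_orbital \<noteq> meeting_orbital" "ratio_orbital k \<noteq> equal_orbital" "ratio_orbital k \<noteq> meeting_orbital"
    using orbital_eq_cards[OF c(1) c(1) c(1) c(2)] orbital_eq_cards[OF c(1) c(3) c(1) c(1)]
      orbital_eq_cards[OF c(1) c(3) c(1) c(2)] i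
    unfolding equal_orbital_def meeting_orbital_def ratio_orbital_def by fastforce+
qed

lemma card_ratio_class_nonsquare:
  assumes "\<not> is_square k" shows "card (ratio_class k) = 4"
proof -
  have k: "k \<noteq> 0" using assms by auto
  have "inverse k \<noteq> k"
  proof
    assume "inverse k = k"
    then have "k * k = 1" using k by (metis right_inverse)
    then have "k = 1 \<or> k = -1" by (simp add: square_eq_1_iff)
    then show False using assms is_square_minus_one by auto
  qed
  moreover have "\<sigma> k \<noteq> k" using assms is_square_if_\<sigma>_fixed by blast
  moreover have "inverse (\<sigma> k) \<noteq> k"
  proof
    assume "inverse (\<sigma> k) = k"
    then have "k * \<sigma> k = 1" using k by (metis \<sigma>_eq_0_iff left_inverse)
    then show False using assms is_square_if_norm_one by blast
  qed
  moreover have "inverse (\<sigma> k) \<noteq> \<sigma> k" using \<open>inverse k \<noteq> k\<close> by (simp flip: \<sigma>_inverse add: \<sigma>_inj)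
  moreover have "inverse k \<noteq> \<sigma> k" using \<open>inverse (\<sigma> k) \<noteq> k\<close> by (metis inverse_inverse_eq)
  moreover have "inverse (\<sigma> k) \<noteq> inverse k" using \<open>\<sigma> k \<noteq> k\<close> by simp
  ultimately have "distinct [k, inverse k, \<sigma> k, inverse (\<sigma> k)]" by (metis distinct_length_2_or_more distinct_singleton)
  then have "card (set [k, inverse k, \<sigma> k, inverse (\<sigma> k)]) = 4" by (simp only: distinct_card) simp
  then show ?thesis using assms by (simp add: ratio_class_def)
qed

lemma ratio_class_nonsquare_subset: "\<not> is_square k \<Longrightarrow> k' \<in> ratio_class k \<Longrightarrow> \<not> is_square k'"
  by (auto simp: ratio_class_def is_square_inverse_iff is_square_\<sigma>_iff split: if_splits)

lemma card_ratio_orbital_nonsquares: "4 * card (ratio_orbital ` {k. \<not> is_square k}) = half_order"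
proof -
  have nz: "k \<noteq> 0 \<and> k \<noteq> 1" if "\<not> is_square k" for k :: 'a using that by auto
  have "4 * card (ratio_orbital ` {k. \<not> is_square k}) = card {k::'a. \<not> is_square k}"
  proof (rule card_image_fibres)
    fix k assume "k \<in> {k::'a. \<not> is_square k}"
    then have k: "\<not> is_square k" by simp
    have "{x \<in> {k. \<not> is_square k}. ratio_orbital x = ratio_orbital k} = ratio_class k"
    proof (intro subset_antisym subsetI)
      fix x assume "x \<in> {x \<in> {k. \<not> is_square k}. ratio_orbital x = ratio_orbital k}"
      then have "\<not> is_square x" "ratio_orbital k = ratio_orbital x" by simp_all
      then show "x \<in> ratio_class k" using ratio_orbital_eq_iff nz nz[OF k] by blast
    next
      fix x assume x: "x \<in> ratio_class k"
      then have "\<not> is_square x" using ratio_class_nonsquare_subset[OF k] by blast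
      moreover from this x have "ratio_orbital k = ratio_orbital x" using ratio_orbital_eq_iff nz nz[OF k] by blast
      ultimately show "x \<in> {x \<in> {k. \<not> is_square k}. ratio_orbital x = ratio_orbital k}" by simp
    qed
    then show "card {x \<in> {k. \<not> is_square k}. ratio_orbital x = ratio_orbital k} = 4"
      using card_ratio_class_nonsquare[OF k] by simp
  qed simp
  then show ?thesis by (simp add: card_nonsquares)
qed

lemma inverse_eq_self_iff: "k \<noteq> 0 \<Longrightarrow> inverse k = k \<longleftrightarrow> k = 1 \<or> k = (-1::'a)"
  by (metis inverse_1 inverse_minus_eq right_inverse square_eq_1_iff)

lemma card_ratio_orbital_squares:
  "2 * card (ratio_orbital ` {k. is_square k \<and> k \<notin> {0, 1, -1}}) = half_order - 2"
proof -
  let ?Q = "{k::'a. is_square k \<and> k \<notin> {0, 1, -1}}"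
  have "2 * card (ratio_orbital ` ?Q) = card ?Q"
  proof (rule card_image_fibres)
    fix k assume "k \<in> ?Q"
    then have k: "is_square k" "k \<noteq> 0" "k \<noteq> 1" "k \<noteq> -1" by simp_all
    have inv: "inverse k \<noteq> 0" "inverse k \<noteq> 1" "inverse k \<noteq> -1" "is_square (inverse k)"
      using k inverse_eq_iff_eq[of k "-1"] by (auto simp: is_square_inverse_iff inverse_eq_1_iff)
    have "{x \<in> ?Q. ratio_orbital x = ratio_orbital k} = {k, inverse k}"
    proof (intro subset_antisym subsetI)
      fix x assume "x \<in> {x \<in> ?Q. ratio_orbital x = ratio_orbital k}"
      then have x: "x \<noteq> 0" "x \<noteq> 1" "ratio_orbital k = ratio_orbital x" by simp_all
      then have "x \<in> ratio_class k" using ratio_orbital_eq_iff[OF k(2,3) x(1,2)] by simp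
      then show "x \<in> {k, inverse k}" using k(1) by (simp add: ratio_class_def)
    next
      fix x assume "x \<in> {k, inverse k}"
      then show "x \<in> {x \<in> ?Q. ratio_orbital x = ratio_orbital k}"
        using k inv ratio_orbital_inverse[OF k(2)] by (elim insertE) simp_all
    qed
    then show "card {x \<in> ?Q. ratio_orbital x = ratio_orbital k} = 2"
      using inverse_eq_self_iff[OF k(2)] k by simp
  qed simp
  moreover have "?Q = {x. x \<noteq> 0 \<and> is_square x} - {1, -1}" by auto
  then have "card ?Q = half_order - 2"
    using is_square_minus_one minus_one_neq_one by (simp add: card_Diff_subset card_nonzero_squares)
  ultimately show ?thesis by simp
qed

text \<open>
  One class of meeting pairs, \<open>half_order / 4\<close> classes of nonsquare ratios,
  \<open>(half_order - 2) / 2\<close> classes of square ratios other than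
  \<open>-1\<close>, and the class of \<open>-1\<close>.
\<close>
lemma num_classes_M_scheme: "8 * num_classes (hyperbolic_lines :: ('a^3) set set) M_scheme = 3 * CARD('a) + 5"
proof -
  let ?N = "{k::'a. \<not> is_square k}" and ?Q = "{k::'a. is_square k \<and> k \<notin> {0, 1, -1}}"
  have "half_order \<noteq> 0" "even half_order" using half_order_facts by auto
  then have "half_order \<ge> 2" by presburger
  have split: "UNIV - {0, 1} = insert (-1) (?N \<union> ?Q)"
    using is_square_minus_one minus_one_neq_one by auto
  have disj1: "ratio_orbital ` ?N \<inter> ratio_orbital ` ?Q = {}"
  proof -
    have False if "ratio_orbital x = ratio_orbital y" "\<not> is_square x" "is_square y" "y \<noteq> 0" "y \<noteq> 1" for x y
    proof -
      have "x \<noteq> 0" "x \<noteq> 1" using that(2) by auto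
      then have "y \<in> ratio_class x" using ratio_orbital_eq_iff that by blast
      then show False using ratio_class_nonsquare_subset that by blast
    qed
    then show ?thesis by (force simp: disjoint_iff)
  qed
  have disj2: "ratio_orbital (-1) \<notin> ratio_orbital ` (?N \<union> ?Q)"
  proof
    assume "ratio_orbital (-1) \<in> ratio_orbital ` (?N \<union> ?Q)"
    then obtain x where x: "ratio_orbital (-1) = ratio_orbital x" "x \<in> ?N \<union> ?Q" by blast
    then have x': "x \<noteq> 0" "x \<noteq> 1" "x \<noteq> -1" using is_square_minus_one by auto
    have "x \<in> ratio_class (-1)" using x(1) ratio_orbital_eq_iff[of "-1" x] x' minus_one_neq_one by simp
    then show False using x' by (simp add: ratio_class_def is_square_minus_one)
  qed
  have "meeting_orbital \<notin> ratio_orbital ` (UNIV - {0, 1})" "equal_orbital \<notin> insert meeting_orbital (ratio_orbital ` (UNIV - {0, 1}))"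
    using distinct_orbitals distinct_orbitals(1)[of "-1"] minus_one_neq_one by force+
  note d = this
  have "M_scheme - {equal_orbital} = insert meeting_orbital (ratio_orbital ` (UNIV - {0, 1}))"
    unfolding M_scheme_cases using d by blast
  then have "num_classes (hyperbolic_lines :: ('a^3) set set) M_scheme = card (insert meeting_orbital (ratio_orbital ` (UNIV - {0, 1})))"
    unfolding num_classes_def equal_orbital_eq[symmetric] by simp
  also have "\<dots> = Suc (card (ratio_orbital ` (UNIV - {0, 1})))" using d by simp
  also have "card (ratio_orbital ` (UNIV - {0, 1})) = Suc (card (ratio_orbital ` (?N \<union> ?Q)))"
    unfolding split image_insert using disj2 by (simp del: image_Un)
  also have "card (ratio_orbital ` (?N \<union> ?Q)) = card (ratio_orbital ` ?N) + card (ratio_orbital ` ?Q)"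
    unfolding image_Un using disj1 by (intro card_Un_disjoint) auto
  finally have "num_classes (hyperbolic_lines :: ('a^3) set set) M_scheme = Suc (Suc (card (ratio_orbital ` ?N) + card (ratio_orbital ` ?Q)))" .
  moreover have "CARD('a) = 2 * half_order + 1" using half_order_facts(1) r_ge_3 by (simp add: card_field)
  ultimately show ?thesis using card_ratio_orbital_nonsquares card_ratio_orbital_squares \<open>half_order \<ge> 2\<close> by simp
qed

section \<open>Non-symmetry for q greater than 9\<close>

text \<open>
  The map \<open>x \<mapsto> (t x - t k) / (t x - 1)\<close> interchanges
  \<open>1\<close> with \<open>\<infinity>\<close>, and sends \<open>k\<close> to
  \<open>0\<close> and \<open>0\<close> to \<open>t k\<close>. Its determinant is
  \<open>t (k - 1)\<close>, so \<open>t\<close> has to be the automorphism belonging to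
  \<open>k - 1\<close>.
\<close>
lemma ratio_orbital_converse:
  assumes k: "k \<noteq> 0" "k \<noteq> 1"
  shows "(ratio_orbital k)\<inverse> = ratio_orbital (twist (k - 1) k)"
proof -
  define t where "t = twist (k - 1)"
  let ?g = "twisted_frac 1 (- t k) 1 (-1)"
  have det: "1 * (-1) - (- t k) * 1 = t (k - 1)" by (simp add: t_def)
  have t: "twist (1 * (-1) - (- t k) * 1) = t" unfolding det unfolding t_def twist_twist_arg ..
  have t0: "t (k - 1) \<noteq> 0" unfolding t_def twist_simps(9) using k by simp
  moreover have "t (k - 1) = t k - 1" by (simp add: t_def)
  ultimately have tk1: "t k \<noteq> 1" by auto
  have nz: "t k \<noteq> 0" "t 1 = 1" "t 0 = 0" using k by (simp_all add: t_def)
  have g: "?g \<in> M_perms" by (rule twisted_frac_in_M) (use det t0 in simp)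
  have "?g None = Some 1" "?g (Some 0) = Some (t k)" "?g (Some 1) = None" "?g (Some k) = Some 0"
    unfolding twisted_frac_apply t using nz tk1 by simp_all
  then have im: "?g ` {Some 1, Some k} = base" "?g ` base = {Some 1, Some (t k)}" by simp_all
  have "(ratio_orbital k)\<inverse> = orbital {Some 1, Some k} base" unfolding ratio_orbital_def by (rule orbital_converse)
  also have "\<dots> = orbital base {Some 1, Some (t k)}"
    using orbital_image[OF g, of "{Some 1, Some k}" base] unfolding im by simp
  finally show ?thesis by (simp add: ratio_orbital_def t_def)
qed

text \<open>
  Take \<open>k = w\<^sup>2\<close> with \<open>w = (1 + m) / (1 - m)\<close> for a
  nonsquare \<open>m\<close>; then \<open>k - 1 = 4 m / (1 - m)\<^sup>2\<close> is a
  nonsquare. The conditions on \<open>\<sigma> k\<close> say that \<open>\<sigma> w\<close>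
  is none of \<open>w\<close>, \<open>- w\<close>, \<open>1 / w\<close>,
  \<open>- 1 / w\<close>, and translate into \<open>\<sigma> m \<noteq> m\<close>,
  \<open>m \<sigma> m \<noteq> 1\<close>, \<open>\<sigma> m \<noteq> - m\<close>,
  \<open>m \<sigma> m \<noteq> - 1\<close>. The first two hold for every nonsquare; the
  other two exclude at most \<open>(r - 1) + (r + 1)\<close> elements, which is less
  than \<open>(r\<^sup>2 - 1) / 2\<close>.
\<close>
lemma exists_nonsymmetric_ratio:
  assumes "r \<ge> 5"
  obtains k where "k \<noteq> 0" "k \<noteq> 1" "is_square k" "\<not> is_square (k - 1)" "\<sigma> k \<noteq> k" "\<sigma> k \<noteq> inverse k"
proof -
  let ?A = "{m::'a. m ^ (r - 1) = -1}" and ?B = "{m::'a. m ^ (r + 1) = -1}"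
  have "card (?A \<union> ?B) \<le> card ?A + card ?B" by (rule card_Un_le)
  also have "\<dots> \<le> (r - 1) + (r + 1)" using assms by (intro add_mono card_power_eq_le) auto
  also have "\<dots> < half_order"
  proof -
    have "5 * r \<le> r\<^sup>2" using assms by (simp add: power2_eq_square)
    then have "4 * r + 1 < r\<^sup>2" using assms by linarith
    then have "4 * r < 2 * half_order" unfolding half_order_facts(1) by simp
    then show ?thesis using assms by simp
  qed
  finally have "card (?A \<union> ?B) < card {m::'a. \<not> is_square m}" by (simp add: card_nonsquares)
  then have "\<not> {m::'a. \<not> is_square m} \<subseteq> ?A \<union> ?B" using card_mono[of "?A \<union> ?B"] by (meson finite linorder_not_le)
  then obtain m :: 'a where m: "\<not> is_square m" "m ^ (r - 1) \<noteq> -1" "m ^ (r + 1) \<noteq> -1" by blast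
  have m0: "m \<noteq> 0" "m \<noteq> 1" "m \<noteq> -1" using m(1) is_square_minus_one by auto
  have m1: "\<sigma> m \<noteq> - m" using \<sigma>_eq_mult_iff[OF m0(1), of "-1"] m(2) by simp
  have m2: "m * \<sigma> m \<noteq> -1" using m(3) unfolding mult_\<sigma> .
  have nz: "1 - m \<noteq> 0" "1 + m \<noteq> 0" using m0 by (auto simp: add_eq_0_iff)
  have \<sigma>nz: "1 - \<sigma> m \<noteq> 0" "1 + \<sigma> m \<noteq> 0" using nz \<sigma>_eq_0_iff[of "1 - m"] \<sigma>_eq_0_iff[of "1 + m"] by (simp_all add: \<sigma>_diff \<sigma>_add \<sigma>_1)
  define w where "w = (1 + m) / (1 - m)"
  have \<sigma>w: "\<sigma> w = (1 + \<sigma> m) / (1 - \<sigma> m)" unfolding w_def divide_inverse by (simp add: \<sigma>_mult \<sigma>_inverse \<sigma>_add \<sigma>_diff \<sigma>_1)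
  have w0: "w \<noteq> 0" using nz by (simp add: w_def)
  have w2: "w\<^sup>2 - 1 = 4 * m / (1 - m)\<^sup>2"
  proof -
    have "w\<^sup>2 - 1 = ((1 + m)\<^sup>2 - (1 - m)\<^sup>2) / (1 - m)\<^sup>2"
      using nz by (simp add: w_def power_divide diff_divide_distrib)
    also have "(1 + m)\<^sup>2 - (1 - m)\<^sup>2 = 4 * m" by (simp add: power2_eq_square algebra_simps)
    finally show ?thesis .
  qed
  have "4 * m / (1 - m)\<^sup>2 = m * (2 / (1 - m))\<^sup>2" by (simp add: power2_eq_square)
  moreover have "\<not> is_square (m * (2 / (1 - m))\<^sup>2)" using m(1) m0 nz two_neq_0 by (subst is_square_mult_iff) auto
  ultimately have nsq: "\<not> is_square (w\<^sup>2 - 1)" unfolding w2 by simp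
  have ne1: "\<sigma> w \<noteq> w"
  proof
    assume "\<sigma> w = w"
    then have "(1 + \<sigma> m) * (1 - m) = (1 + m) * (1 - \<sigma> m)" unfolding \<sigma>w unfolding w_def using nz \<sigma>nz by (simp add: frac_eq_eq)
    moreover have "(1 + \<sigma> m) * (1 - m) - (1 + m) * (1 - \<sigma> m) = 2 * (\<sigma> m - m)" by (simp add: algebra_simps)
    ultimately have "\<sigma> m = m" using two_neq_0 by simp
    with m(1) is_square_if_\<sigma>_fixed show False by blast
  qed
  have ne2: "\<sigma> w \<noteq> - w"
  proof
    assume "\<sigma> w = - w"
    then have "(1 + \<sigma> m) * (1 - m) = - (1 + m) * (1 - \<sigma> m)" unfolding \<sigma>w unfolding w_def minus_divide_left using nz \<sigma>nz by (simp only: frac_eq_eq not_False_eq_True)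
    moreover have "(1 + \<sigma> m) * (1 - m) - - (1 + m) * (1 - \<sigma> m) = 2 * (1 - m * \<sigma> m)" by (simp add: algebra_simps)
    ultimately have "m * \<sigma> m = 1" using two_neq_0 by simp
    with m(1) is_square_if_norm_one show False by blast
  qed
  have w\<sigma>w: "w * \<sigma> w = ((1 + m) * (1 + \<sigma> m)) / ((1 - m) * (1 - \<sigma> m))" unfolding \<sigma>w unfolding w_def by simp
  have ne3: "w * \<sigma> w \<noteq> 1"
  proof
    assume "w * \<sigma> w = 1"
    then have "(1 + m) * (1 + \<sigma> m) = (1 - m) * (1 - \<sigma> m)" unfolding w\<sigma>w using nz \<sigma>nz by simp
    moreover have "(1 + m) * (1 + \<sigma> m) - (1 - m) * (1 - \<sigma> m) = 2 * (m + \<sigma> m)" by (simp add: algebra_simps)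
    ultimately have "2 * (m + \<sigma> m) = 0" by simp
    then have "m + \<sigma> m = 0" using two_neq_0 by (simp only: mult_eq_0_iff simp_thms)
    with m1 show False by (simp add: add_eq_0_iff)
  qed
  have ne4: "w * \<sigma> w \<noteq> -1"
  proof
    assume "w * \<sigma> w = -1"
    then have "(1 + m) * (1 + \<sigma> m) = - ((1 - m) * (1 - \<sigma> m))" unfolding w\<sigma>w using nz \<sigma>nz
      by (subst (asm) nonzero_divide_eq_eq) simp_all
    moreover have "(1 + m) * (1 + \<sigma> m) - - ((1 - m) * (1 - \<sigma> m)) = 2 * (1 + m * \<sigma> m)" by (simp add: algebra_simps)
    ultimately have "2 * (1 + m * \<sigma> m) = 0" by simp
    then have "1 + m * \<sigma> m = 0" using two_neq_0 by (simp only: mult_eq_0_iff simp_thms)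
    with m2 show False by (simp add: add_eq_0_iff)
  qed
  have \<sigma>k: "\<sigma> (w\<^sup>2) = (\<sigma> w)\<^sup>2" by (simp add: power2_eq_square \<sigma>_mult)
  show thesis
  proof (rule that)
    show "w\<^sup>2 \<noteq> 0" using w0 by simp
    show "w\<^sup>2 \<noteq> 1" using nsq by auto
    show "is_square (w\<^sup>2)" by simp
    show "\<not> is_square (w\<^sup>2 - 1)" by (rule nsq)
    show "\<sigma> (w\<^sup>2) \<noteq> w\<^sup>2" unfolding \<sigma>k power2_eq_iff using ne1 ne2 by blast
    show "\<sigma> (w\<^sup>2) \<noteq> inverse (w\<^sup>2)"
    proof
      assume "\<sigma> (w\<^sup>2) = inverse (w\<^sup>2)"
      then have "w\<^sup>2 * (\<sigma> w)\<^sup>2 = 1" using w0 unfolding \<sigma>k by simp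
      then have "(w * \<sigma> w)\<^sup>2 = 1" by (simp add: power_mult_distrib)
      then show False using ne3 ne4 by (simp add: power2_eq_1_iff)
    qed
  qed
qed

lemma not_symmetric_M_scheme: 
  assumes "r \<ge> 5" shows "\<not> symmetric_scheme (M_scheme :: ('a^3) set rel set)"
proof
  assume sym: "symmetric_scheme (M_scheme :: ('a^3) set rel set)"
  obtain k where k: "k \<noteq> 0" "k \<noteq> 1" "is_square k" "\<not> is_square (k - 1)" "\<sigma> k \<noteq> k" "\<sigma> k \<noteq> inverse k"
    by (rule exists_nonsymmetric_ratio[OF assms])
  have "ratio_orbital k \<in> M_scheme" using k unfolding M_scheme_cases by blast
  then have "sym (ratio_orbital k)" using sym unfolding symmetric_scheme_def by blast
  then have "ratio_orbital k = ratio_orbital (\<sigma> k)"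
    using ratio_orbital_converse[OF k(1,2)] k(4) by (simp add: sym_conv_converse_eq twist_def)
  moreover have "\<sigma> k \<noteq> 0" "\<sigma> k \<noteq> 1" using k(1,2) \<sigma>_eq_0_iff \<sigma>_inj[of k 1] \<sigma>_1 by simp_all
  ultimately have "\<sigma> k \<in> ratio_class k" using ratio_orbital_eq_iff k by blast
  then show False using k by (simp add: ratio_class_def)
qed

end

section \<open>A criterion for P-polynomial schemes\<close>

text \<open>
  The hypotheses say that \<open>R i\<close> consists of pairs at distance \<open>i\<close>
  in the graph \<open>R 1\<close>: \<open>step\<close> provides a walk of length
  \<open>i\<close>, and by \<open>bound\<close> a walk of length \<open>n\<close> only reaches
  \<open>R j\<close> with \<open>j \<le> n\<close>. The graph is then distance-regular
  because its parameters are intersection numbers of the scheme.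
\<close>
lemma P_polynomial_schemeI:
  assumes scheme: "association_scheme X Rs" and sym: "symmetric_scheme Rs"
    and d: "num_classes X Rs = d" "d \<ge> 1"
    and bij: "bij_betw R {0..d} Rs" and R0: "R 0 = Id_on X"
    and step: "\<And>i. i < d \<Longrightarrow> R (Suc i) \<subseteq> R i O R 1"
    and bound: "\<And>i j x y z. i \<le> d \<Longrightarrow> j \<le> d \<Longrightarrow> (x, y) \<in> R i \<Longrightarrow> (y, z) \<in> R 1 \<Longrightarrow> (x, z) \<in> R j \<Longrightarrow> j \<le> Suc i"
  shows "P_polynomial_scheme X Rs"
proof -
  have X: "finite X" "X \<noteq> {}" and part: "partition_on (X \<times> X) Rs"
    and const: "\<And>R S T. R \<in> Rs \<Longrightarrow> S \<in> Rs \<Longrightarrow> T \<in> Rs \<Longrightarrow>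
      \<exists>n. \<forall>(x, y)\<in>T. card {z \<in> X. (x, z) \<in> R \<and> (z, y) \<in> S} = n"
    using scheme unfolding association_scheme_def by blast+
  have union: "\<Union> Rs = X \<times> X" and disj: "disjoint Rs" and nonempty: "{} \<notin> Rs"
    using part unfolding partition_on_def by simp_all
  have RRs: "R i \<in> Rs" if "i \<le> d" for i using bij that unfolding bij_betw_def by auto
  have RX: "R i \<subseteq> X \<times> X" if "i \<le> d" for i using RRs[OF that] union by blast
  have Rne: "R i \<noteq> {}" if "i \<le> d" for i using RRs[OF that] nonempty by metis
  have ex: "\<exists>i\<le>d. (x, y) \<in> R i" if "x \<in> X" "y \<in> X" for x y
  proof -
    have "(x, y) \<in> \<Union> Rs" using that union by simp
    then obtain S where S: "S \<in> Rs" "(x, y) \<in> S" by blast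
    moreover have "Rs = R ` {0..d}" using bij unfolding bij_betw_def by simp
    ultimately show ?thesis by auto
  qed
  have uniq: "i = j" if ij: "i \<le> d" "j \<le> d" "(x, y) \<in> R i" "(x, y) \<in> R j" for i j x y
  proof -
    have "R i = R j"
    proof (rule ccontr)
      assume "R i \<noteq> R j"
      then have "R i \<inter> R j = {}" using disjointD[OF disj RRs[OF ij(1)] RRs[OF ij(2)]] by blast
      with ij(3,4) show False by blast
    qed
    moreover have "inj_on R {0..d}" using bij by (rule bij_betw_imp_inj_on)
    ultimately show ?thesis using ij(1,2) by (simp add: inj_on_eq_iff)
  qed
  have symR: "sym (R 1)" using sym RRs[of 1] d(2) unfolding symmetric_scheme_def by blast
  have walk: "(x, y) \<in> R 1 ^^ i" if "i \<le> d" "(x, y) \<in> R i" for i x y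
    using that
  proof (induction i arbitrary: y)
    case 0
    then show ?case using R0 by auto
  next
    case (Suc i)
    then have "(x, y) \<in> R i O R 1" using step[of i] by auto
    then obtain z where z: "(x, z) \<in> R i" "(z, y) \<in> R 1" by blast
    have "(x, z) \<in> R 1 ^^ i" using Suc z(1) by simp
    then show ?case using z(2) by auto
  qed
  have short: "\<exists>j\<le>n. j \<le> d \<and> (x, y) \<in> R j" if "x \<in> X" "(x, y) \<in> R 1 ^^ n" for n x y
    using that
  proof (induction n arbitrary: y)
    case 0
    then show ?case using R0 by auto
  next
    case (Suc n)
    then obtain z where z: "(x, z) \<in> R 1 ^^ n" "(z, y) \<in> R 1" by auto
    then obtain j where j: "j \<le> n" "j \<le> d" "(x, z) \<in> R j" using Suc by blast
    have "y \<in> X" using z(2) RX[of 1] d(2) by blast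
    then obtain j' where j': "j' \<le> d" "(x, y) \<in> R j'" using ex[OF Suc.prems(1)] by blast
    then have "j' \<le> Suc j" using bound[OF j(2) j'(1) j(3) z(2)] by blast
    with j j' show ?case by (intro exI[of _ j']) simp
  qed
  have dist: "graph_dist (R 1) x y = i" if i: "i \<le> d" "(x, y) \<in> R i" for i x y
    unfolding graph_dist_def
  proof (rule Least_equality)
    show "(x, y) \<in> R 1 ^^ i" using walk[OF i] .
    fix n assume "(x, y) \<in> R 1 ^^ n"
    moreover have "x \<in> X" using RX[OF i(1)] i(2) by blast
    ultimately obtain j where "j \<le> n" "j \<le> d" "(x, y) \<in> R j" using short by blast
    then show "i \<le> n" using uniq[OF i(1) _ i(2)] by blast
  qed
  have dist_iff: "graph_dist (R 1) x y = i \<longleftrightarrow> i \<le> d \<and> (x, y) \<in> R i" if xy: "x \<in> X" "y \<in> X" for x y i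
    using ex[OF xy] dist by blast
  have rel: "distance_rel X (R 1) i = (if i \<le> d then R i else {})" for i
    unfolding distance_rel_def using dist_iff[of _ _ i] RX[of i] by auto
  have "R 1 \<inter> Id_on X = {}" using uniq[of 0 1] d(2) R0 by auto
  then have irr: "irrefl (R 1)" using RX[of 1] d(2) unfolding irrefl_def by blast
  have graph: "simple_graph X (R 1)"
    unfolding simple_graph_def using X(1) RX[of 1] d(2) symR irr by simp
  have conn: "connected_graph X (R 1)"
    unfolding connected_graph_def
  proof (intro conjI ballI X(2))
    fix x y assume "x \<in> X" "y \<in> X"
    then obtain i where "(x, y) \<in> R 1 ^^ i" using ex walk by blast
    then show "(x, y) \<in> (R 1)\<^sup>*" by (rule relpow_imp_rtrancl)
  qed
  have cst: "\<exists>n. \<forall>(x, y)\<in>R i. card {z \<in> X. (y, z) \<in> R 1 \<and> graph_dist (R 1) x z = j} = n" if i: "i \<le> d" for i j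
  proof (cases "j \<le> d")
    case True
    obtain n where n: "\<forall>(x, y)\<in>R i. card {z \<in> X. (x, z) \<in> R j \<and> (z, y) \<in> R 1} = n"
      using const[OF RRs[OF True] RRs[OF d(2)] RRs[OF i]] by blast
    have "card {z \<in> X. (y, z) \<in> R 1 \<and> graph_dist (R 1) x z = j} = n" if xy: "(x, y) \<in> R i" for x y
    proof -
      have "x \<in> X" using RX[OF i] xy by blast
      then have "{z \<in> X. (y, z) \<in> R 1 \<and> graph_dist (R 1) x z = j} = {z \<in> X. (x, z) \<in> R j \<and> (z, y) \<in> R 1}"
        using dist_iff True symD[OF symR] by blast
      then show ?thesis using n xy by auto
    qed
    then show ?thesis by blast
  next
    case False
    have "card {z \<in> X. (y, z) \<in> R 1 \<and> graph_dist (R 1) x z = j} = 0" if xy: "(x, y) \<in> R i" for x y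
    proof -
      have "x \<in> X" using RX[OF i] xy by blast
      then have "{z \<in> X. (y, z) \<in> R 1 \<and> graph_dist (R 1) x z = j} = {}"
        using dist_iff False by blast
      then show ?thesis by (simp only: card.empty)
    qed
    then show ?thesis by blast
  qed
  have "distance_regular X (R 1)"
    unfolding distance_regular_def
  proof (intro conjI graph conn allI)
    fix i
    show "\<exists>b c. \<forall>(x, y) \<in> distance_rel X (R 1) i.
        card {z \<in> X. (y, z) \<in> R 1 \<and> graph_dist (R 1) x z = i + 1} = b \<and>
        card {z \<in> X. (y, z) \<in> R 1 \<and> graph_dist (R 1) x z + 1 = i} = c"
    proof (cases "i \<le> d")
      case True
      obtain b where b: "\<forall>(x, y)\<in>R i. card {z \<in> X. (y, z) \<in> R 1 \<and> graph_dist (R 1) x z = i + 1} = b"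
        using cst[OF True] by blast
      obtain c where c: "\<forall>(x, y)\<in>R i. card {z \<in> X. (y, z) \<in> R 1 \<and> graph_dist (R 1) x z + 1 = i} = c"
      proof (cases i)
        case 0
        then show thesis using that[of 0] by simp
      next
        case (Suc i')
        obtain c where "\<forall>(x, y)\<in>R i. card {z \<in> X. (y, z) \<in> R 1 \<and> graph_dist (R 1) x z = i'} = c"
          using cst[OF True] by blast
        then show thesis using that[of c] Suc by simp
      qed
      show ?thesis unfolding rel using True b c by (intro exI[of _ b] exI[of _ c]) auto
    next
      case False
      then have "distance_rel X (R 1) i = {}" by (simp only: rel if_False)
      then show ?thesis by simp
    qed
  qed
  moreover have "graph_diameter X (R 1) = d"
  proof -
    have "{graph_dist (R 1) x y | x y. x \<in> X \<and> y \<in> X} = {0..d}"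
    proof (intro subset_antisym subsetI)
      fix i assume "i \<in> {graph_dist (R 1) x y | x y. x \<in> X \<and> y \<in> X}"
      then show "i \<in> {0..d}" using dist_iff by auto
    next
      fix i assume "i \<in> {0..d}"
      then have "i \<le> d" by simp
      then obtain x y where "(x, y) \<in> R i" using Rne by fastforce
      then have "graph_dist (R 1) x y = i" "x \<in> X" "y \<in> X" using dist RX \<open>i \<le> d\<close> by blast+
      then show "i \<in> {graph_dist (R 1) x y | x y. x \<in> X \<and> y \<in> X}" by blast
    qed
    moreover have "Max {0..d} = d" by (intro Max_eqI) auto
    ultimately show ?thesis unfolding graph_diameter_def by simp
  qed
  ultimately show ?thesis
    unfolding P_polynomial_scheme_def d(1) using scheme sym bij R0 rel by (intro conjI exI[of _ R]) auto
qed

context square_order_field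
begin

section \<open>The scheme of M(9)\<close>

lemma orbital_comp: "orbital s t \<subseteq> orbital s u O orbital u t"
  unfolding orbital_def by blast

text \<open>
  The stabilizer of \<open>{\<infinity>, 0}\<close> moves \<open>{1, k}\<close> to scaled,
  possibly twisted copies of \<open>{1, k}\<close> or \<open>{1, 1 / k}\<close>.
\<close>
lemma ratio_orbital_neighbour:
  assumes t: "card t = 2" and k: "k \<noteq> 0" "k \<noteq> 1" and eq: "orbital base t = ratio_orbital k"
  shows "\<exists>m e w. m \<noteq> 0 \<and> (w = k \<or> w = inverse k) \<and> t = {Some m, Some (m * twist e w)}"
proof -
  have c: "card base = 2" "card {Some 1, Some k} = 2" using k by simp_all
  obtain g where g: "g \<in> M_perms" "g ` base = base" "g ` {Some 1, Some k} = t"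
    using eq[symmetric] unfolding ratio_orbital_def orbital_eq_iff[OF c c(1) t] by blast
  obtain m where m: "m \<noteq> 0" "(\<forall>x. x \<noteq> 0 \<longrightarrow> g (Some x) = Some (m * twist m x)) \<or>
    (\<forall>x. x \<noteq> 0 \<longrightarrow> g (Some x) = Some (m / twist m x))"
    using M_fixing_base[OF g(1,2)] by blast
  have t': "t = {g (Some 1), g (Some k)}" using g(3) by simp
  from m(2) show ?thesis
  proof
    assume "\<forall>x. x \<noteq> 0 \<longrightarrow> g (Some x) = Some (m * twist m x)"
    then have "t = {Some m, Some (m * twist m k)}" unfolding t' using k by simp
    with m(1) show ?thesis by blast
  next
    assume "\<forall>x. x \<noteq> 0 \<longrightarrow> g (Some x) = Some (m / twist m x)"
    then have "t = {Some m, Some (m * twist m (inverse k))}" unfolding t' using k by (simp add: divide_inverse)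
    with m(1) show ?thesis by blast
  qed
qed

lemma orbital_base_pair:
  assumes "x \<noteq> 0" shows "orbital base {Some x, Some y} = ratio_orbital (twist x (y / x))"
proof -
  define m where "m = inverse (twist x x)"
  have m0: "m \<noteq> 0" using assms by (simp add: m_def)
  have tm: "twist m = twist x" unfolding m_def by (rule twist_cong) (simp only: is_square_inverse_iff is_square_twist_iff)
  obtain g where g: "g \<in> M_perms" "g None = None" "g (Some 0) = Some 0" "\<forall>z. g (Some z) = Some (m * twist m z)"
    using scaling_in_M[OF m0] by blast
  have "m * twist x x = 1" "m * twist x y = twist x (y / x)"
    using assms by (simp_all add: m_def divide_inverse mult.commute)
  then have "g (Some x) = Some 1" "g (Some y) = Some (twist x (y / x))"
    using g(4) by (simp_all add: tm)
  then have "g ` base = base" "g ` {Some x, Some y} = {Some 1, Some (twist x (y / x))}" using g(2,3) by simp_all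
  then show ?thesis using orbital_image[OF g(1), of base "{Some x, Some y}"] by (simp add: ratio_orbital_def)
qed

text \<open>
  The ratio is the cross ratio of the four points up to \<open>\<sigma>\<close>, as
  \<open>x \<mapsto> (x - b) / (x - a)\<close> moves \<open>{a, b}\<close> to
  \<open>{\<infinity>, 0}\<close>.
\<close>
lemma orbital_finite_pairs:
  assumes "distinct [a, b, c, d]"
  shows "\<exists>e. orbital {Some a, Some b} {Some c, Some d} = ratio_orbital (twist e (((d - b) * (c - a)) / ((d - a) * (c - b))))"
proof -
  define t where "t = twist (b - a)"
  let ?g = "twisted_frac 1 (- t b) 1 (- t a)"
  have det: "1 * (- t a) - (- t b) * 1 = t (b - a)" by (simp add: t_def)
  have t: "twist (1 * (- t a) - (- t b) * 1) = t" unfolding det unfolding t_def twist_twist_arg ..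
  have inj: "t u = t v \<longleftrightarrow> u = v" for u v
  proof -
    have "t u = t v \<longleftrightarrow> t (u - v) = 0" by (simp add: t_def)
    also have "\<dots> \<longleftrightarrow> u = v" unfolding t_def twist_simps(9) by simp
    finally show ?thesis .
  qed
  have g: "?g \<in> M_perms"
  proof (rule twisted_frac_in_M)
    have "t (b - a) \<noteq> 0" unfolding t_def twist_simps(9) using assms by auto
    then show "1 * (- t a) - (- t b) * 1 \<noteq> 0" unfolding det .
  qed
  have val: "?g (Some u) = (if u = a then None else Some (t ((u - b) / (u - a))))" for u
    unfolding twisted_frac_apply t using inj[of u a] by (simp add: t_def divide_inverse)
  have "orbital {Some a, Some b} {Some c, Some d} = orbital base {Some (t ((c - b) / (c - a))), Some (t ((d - b) / (d - a)))}"
  proof -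
    have "?g (Some a) = None" "?g (Some b) = Some 0" "?g (Some c) = Some (t ((c - b) / (c - a)))" "?g (Some d) = Some (t ((d - b) / (d - a)))"
      unfolding val using assms by (auto simp: t_def)
    then have "?g ` {Some a, Some b} = base" "?g ` {Some c, Some d} = {Some (t ((c - b) / (c - a))), Some (t ((d - b) / (d - a)))}"
      by simp_all
    then show ?thesis using orbital_image[OF g, of "{Some a, Some b}" "{Some c, Some d}"] by simp
  qed
  also have "\<dots> = ratio_orbital (twist (t ((c - b) / (c - a))) (t ((d - b) / (d - a)) / t ((c - b) / (c - a))))"
    using assms by (intro orbital_base_pair) (auto simp: t_def)
  also have "t ((d - b) / (d - a)) / t ((c - b) / (c - a)) = t (((d - b) / (d - a)) / ((c - b) / (c - a)))"
    by (simp add: t_def divide_inverse)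
  also have "((d - b) / (d - a)) / ((c - b) / (c - a)) = ((d - b) * (c - a)) / ((d - a) * (c - b))"
    by simp
  finally have *: "orbital {Some a, Some b} {Some c, Some d} =
    ratio_orbital (twist (t ((c - b) / (c - a))) (t (((d - b) * (c - a)) / ((d - a) * (c - b)))))" .
  have e: "t ((c - b) / (c - a)) \<noteq> 0" unfolding t_def twist_simps(9) using assms by auto
  have e': "b - a \<noteq> 0" using assms by auto
  have tw: "twist (t ((c - b) / (c - a))) (t z) = twist (t ((c - b) / (c - a)) * (b - a)) z" for z
    by (subst twist_mult_arg[OF e e']) (simp only: t_def)
  show ?thesis unfolding * tw by (rule exI) (rule refl)
qed


lemma orbital_of_member:
  assumes "R \<in> M_scheme" "(chord s, chord t) \<in> R" "card s = 2" "card t = 2"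
  shows "R = orbital s t"
proof -
  obtain a b where ab: "R = orbital a b" "card a = 2" "card b = 2" using assms(1) unfolding M_scheme_eq by blast
  then have "\<exists>g\<in>M_perms. g ` a = s \<and> g ` b = t" using assms in_orbital_iff by blast
  then show ?thesis using orbital_eq_iff[OF ab(2,3) assms(3,4)] ab(1) by simp
qed

text \<open>
  From here on \<open>q = 9\<close>, the characteristic is 3, and the squares are
  \<open>0\<close>, \<open>1\<close>, \<open>-1\<close>, \<open>\<iota>\<close>,
  \<open>- \<iota>\<close>.
\<close>
context
  fixes \<iota> :: 'a
  assumes r3: "r = 3" and \<iota>: "\<iota> * \<iota> = -1"
begin

lemma three_eq_0: "(3::'a) = 0"
proof -
  have "(of_nat CARD('a) :: 'a) = 0" by (simp only: of_nat_eq_0_iff_char_dvd CHAR_dvd_CARD)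
  then have "(3::'a) * 3 = 0" by (simp add: card_field r3)
  then show ?thesis by (simp only: mult_eq_0_iff disj_absorb)
qed

lemma two_eq: "(2::'a) = -1"
proof -
  have "(2::'a) + 1 = 3" by simp
  then show ?thesis using three_eq_0 by (simp add: add_eq_0_iff2 del: one_add_one)
qed

lemma half_order_eq_4: "half_order = 4" unfolding half_order_def using r3 by simp

lemma \<iota>_neq: "\<iota> \<noteq> 0" "\<iota> \<noteq> 1" "\<iota> \<noteq> -1" and inverse_\<iota>: "inverse \<iota> = - \<iota>" and \<sigma>_\<iota>: "\<sigma> \<iota> = - \<iota>"
proof -
  show "\<iota> \<noteq> 0" "\<iota> \<noteq> 1" "\<iota> \<noteq> -1" using \<iota> minus_one_neq_one by auto
  have "\<iota> * (- \<iota>) = 1" using \<iota> by simp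
  then show "inverse \<iota> = - \<iota>" by (rule inverse_unique)
  show "\<sigma> \<iota> = - \<iota>" by (simp add: \<sigma>_power r3 power3_eq_cube \<iota>)
qed

lemma square_cases:
  assumes "is_square k" "k \<noteq> 0" shows "k = 1 \<or> k = -1 \<or> k = \<iota> \<or> k = - \<iota>"
proof -
  have "k ^ 4 = 1" using assms by (simp add: euler_criterion half_order_eq_4)
  then have "(k * k) * (k * k) = 1" by (simp add: numeral_eq_Suc ac_simps)
  then have "k * k = 1 \<or> k * k = \<iota> * \<iota>" by (simp only: square_eq_1_iff \<iota>)
  then show ?thesis by (simp only: square_eq_1_iff square_eq_iff disj_assoc)
qed

abbreviation \<omega> :: 'a where "\<omega> \<equiv> 1 + \<iota>"

lemma nonsquare_\<omega>: "\<not> is_square \<omega>"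
proof
  assume "is_square \<omega>"
  then have "\<omega> = -1 \<or> \<omega> = - \<iota>" using square_cases[of \<omega>] \<iota>_neq by (auto simp: add_eq_0_iff)
  then show False
  proof
    assume "\<omega> = -1"
    then have "\<iota> = -1 - 1" by (metis add_diff_cancel_left')
    also have "\<dots> = - 2" by simp
    also have "\<dots> = 1" unfolding two_eq by simp
    finally show False using \<iota>_neq by simp
  next
    assume "\<omega> = - \<iota>"
    then have "1 + 2 * \<iota> = 0" by (simp add: algebra_simps mult_2)
    then show False using \<iota>_neq(2) by (simp add: two_eq)
  qed
qed

lemma \<omega>_neq: "\<omega> \<noteq> 0" "\<omega> \<noteq> 1" using nonsquare_\<omega> by auto

lemma ratio_orbital_square:
  assumes "is_square k" "k \<noteq> 0" "k \<noteq> 1"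
  shows "ratio_orbital k = ratio_orbital (-1) \<or> ratio_orbital k = ratio_orbital \<iota>"
  using square_cases[OF assms(1,2)] assms(3) ratio_orbital_inverse[OF \<iota>_neq(1)] inverse_\<iota> by auto

text \<open>
  There are only four nonsquares, and the ratios equivalent to a nonsquare are four in number.
\<close>
lemma ratio_orbital_nonsquare:
  assumes "\<not> is_square k" shows "ratio_orbital k = ratio_orbital \<omega>"
proof -
  have "ratio_class \<omega> = {k. \<not> is_square k}"
  proof (rule card_subset_eq)
    show "ratio_class \<omega> \<subseteq> {k. \<not> is_square k}" using ratio_class_nonsquare_subset[OF nonsquare_\<omega>] by blast
    show "card (ratio_class \<omega>) = card {k::'a. \<not> is_square k}"
      by (simp only: card_ratio_class_nonsquare[OF nonsquare_\<omega>] card_nonsquares half_order_eq_4)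
  qed simp
  then have "k \<in> ratio_class \<omega>" using assms by blast
  moreover have "k \<noteq> 0" "k \<noteq> 1" using assms by auto
  ultimately have "ratio_orbital \<omega> = ratio_orbital k" using ratio_orbital_eq_iff[OF \<omega>_neq] by blast
  then show ?thesis by (rule sym)
qed

text \<open>
  The relations in the order of the distance in the graph of harmonic pairs (ratio
  \<open>-1\<close>). Its valencies are 4, 8, 16, 16: it is the line graph of Tutte's 8-cage,
  the incidence graph of the generalized quadrangle of order \<open>(2, 2)\<close>.
\<close>
definition ranked_orbital :: "nat \<Rightarrow> ('a^3) set rel" where
  "ranked_orbital i = [equal_orbital, ratio_orbital (-1), ratio_orbital \<iota>, meeting_orbital, ratio_orbital \<omega>] ! i"

lemma ranked_orbital_simps: "ranked_orbital 0 = equal_orbital" "ranked_orbital 1 = ratio_orbital (-1)" "ranked_orbital (Suc 0) = ratio_orbital (-1)"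
  "ranked_orbital 2 = ratio_orbital \<iota>" "ranked_orbital 3 = meeting_orbital" "ranked_orbital 4 = ratio_orbital \<omega>"
  by (simp_all add: ranked_orbital_def numeral_eq_Suc)

lemma atLeastAtMost_0_4: "{0..4::nat} = {0, 1, 2, 3, 4}" by auto

lemma M_scheme_9: "M_scheme = ranked_orbital ` {0..4}"
proof -
  have "ratio_orbital ` (UNIV - {0, 1}) = {ratio_orbital (-1), ratio_orbital \<iota>, ratio_orbital \<omega>}"
  proof (intro subset_antisym subsetI)
    fix R assume "R \<in> ratio_orbital ` (UNIV - {0, 1})"
    then obtain k where "k \<noteq> 0" "k \<noteq> 1" "R = ratio_orbital k" by blast
    then show "R \<in> {ratio_orbital (-1), ratio_orbital \<iota>, ratio_orbital \<omega>}"
      using ratio_orbital_square[of k] ratio_orbital_nonsquare[of k] by blast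
  next
    fix R assume "R \<in> {ratio_orbital (-1), ratio_orbital \<iota>, ratio_orbital \<omega>}"
    moreover have "-1 \<in> UNIV - {0, 1::'a}" "\<iota> \<in> UNIV - {0, 1}" "\<omega> \<in> UNIV - {0, 1}"
      using minus_one_neq_one \<iota>_neq \<omega>_neq by auto
    ultimately show "R \<in> ratio_orbital ` (UNIV - {0, 1})" by blast
  qed
  then show ?thesis unfolding M_scheme_cases atLeastAtMost_0_4 image_insert image_empty ranked_orbital_simps by blast
qed

lemma num_classes_9: "num_classes (hyperbolic_lines :: ('a^3) set set) M_scheme = 4"
  using num_classes_M_scheme by (simp add: card_field r3)

lemma bij_ranked_orbital: "bij_betw ranked_orbital {0..4} M_scheme"
proof -
  have fin: "finite (M_scheme :: ('a^3) set rel set)" unfolding M_scheme_9 by simp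
  have mem: "equal_orbital \<in> M_scheme" unfolding M_scheme_cases by blast
  then have "card (M_scheme - {equal_orbital}) = card (M_scheme :: ('a^3) set rel set) - 1" by simp
  then have "card (M_scheme :: ('a^3) set rel set) - 1 = 4"
    using num_classes_9 unfolding num_classes_def equal_orbital_eq by simp
  then have "card (ranked_orbital ` {0..4}) = card {0..4::nat}" unfolding M_scheme_9[symmetric] by simp
  then have "inj_on ranked_orbital {0..4}" by (intro eq_card_imp_inj_on) auto
  then show ?thesis unfolding bij_betw_def M_scheme_9 by simp
qed

lemma ranked_orbital_inj: "i \<le> 4 \<Longrightarrow> j \<le> 4 \<Longrightarrow> ranked_orbital i = ranked_orbital j \<Longrightarrow> i = j"
  using bij_ranked_orbital unfolding bij_betw_def inj_on_def by auto

lemma symmetric_M_scheme_9: "symmetric_scheme (M_scheme :: ('a^3) set rel set)"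
proof -
  have "sym equal_orbital" unfolding equal_orbital_eq by (rule sym_Id_on)
  moreover have "sym meeting_orbital"
    unfolding sym_conv_converse_eq using orbital_meeting[of None "Some 1" "Some 0"]
    by (simp add: orbital_converse meeting_orbital_def)
  moreover have "sym (ratio_orbital (-1))"
    using ratio_orbital_converse[of "-1"] minus_one_neq_one unfolding sym_conv_converse_eq by simp
  moreover have "sym (ratio_orbital \<iota>)"
  proof -
    have "twist e \<iota> = \<iota> \<or> twist e \<iota> = inverse \<iota>" for e by (simp add: twist_def \<sigma>_\<iota> inverse_\<iota>)
    then have "ratio_orbital (twist (\<iota> - 1) \<iota>) = ratio_orbital \<iota>" using ratio_orbital_inverse[OF \<iota>_neq(1)] by metis
    then show ?thesis unfolding sym_conv_converse_eq ratio_orbital_converse[OF \<iota>_neq(1,2)] .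
  qed
  moreover have "sym (ratio_orbital \<omega>)"
    unfolding sym_conv_converse_eq ratio_orbital_converse[OF \<omega>_neq]
    by (rule ratio_orbital_nonsquare) (simp only: is_square_twist_iff nonsquare_\<omega> not_False_eq_True)
  ultimately show ?thesis unfolding symmetric_scheme_def M_scheme_9 atLeastAtMost_0_4 by (simp add: ranked_orbital_simps)
qed

lemma orbital_commute: "card s = 2 \<Longrightarrow> card t = 2 \<Longrightarrow> orbital s t = orbital t s"
  using symmetric_M_scheme_9 orbital_in_M_scheme[of t s] orbital_converse[of t s]
  unfolding symmetric_scheme_def by (simp add: sym_conv_converse_eq)

text \<open>
  The product in the hypothesis differs from the cross ratio by a square factor.
\<close>
lemma orbital_square_cross_ratio:
  assumes "distinct [a, b, c, d]" "is_square ((a - c) * (a - d) * (b - c) * (b - d))"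
  shows "orbital {Some a, Some b} {Some c, Some d} \<in> {ranked_orbital 1, ranked_orbital 2}"
proof -
  define x where "x = ((d - b) * (c - a)) / ((d - a) * (c - b))"
  have nz: "(d - b) * (c - a) \<noteq> 0" "(d - a) * (c - b) \<noteq> 0" using assms(1) by auto
  have x0: "x \<noteq> 0" using nz unfolding x_def by simp
  have "(d - b) * (c - a) - (d - a) * (c - b) = (d - c) * (b - a)" by (simp add: algebra_simps)
  moreover have "(d - c) * (b - a) \<noteq> 0" using assms(1) by auto
  ultimately have "(d - b) * (c - a) \<noteq> (d - a) * (c - b)" by auto
  then have x1: "x \<noteq> 1" using nz unfolding x_def by simp
  have "(d - b) * (c - a) * ((d - a) * (c - b)) = (a - c) * (a - d) * (b - c) * (b - d)" by (simp add: algebra_simps)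
  then have sq: "is_square x" using assms(2) unfolding x_def is_square_divide_iff[OF nz] by simp
  obtain e where e: "orbital {Some a, Some b} {Some c, Some d} = ratio_orbital (twist e x)"
    using orbital_finite_pairs[OF assms(1)] unfolding x_def by blast
  have "is_square (twist e x)" using sq by (simp only: is_square_twist_iff)
  moreover have "twist e x \<noteq> 0" using x0 by simp
  moreover have "twist e x \<noteq> 1"
  proof
    assume "twist e x = 1"
    then have "twist e (twist e x) = twist e 1" by simp
    with x1 show False by simp
  qed
  ultimately show ?thesis using ratio_orbital_square unfolding e ranked_orbital_simps by blast
qed

lemma ranked_orbital_1_neighbour:
  assumes "card t = 2" "orbital base t = ranked_orbital 1"
  shows "\<exists>x. x \<noteq> 0 \<and> t = {Some x, Some (- x)}"
proof -
  obtain m e w where "m \<noteq> 0" "w = -1 \<or> w = inverse (-1)" "t = {Some m, Some (m * twist e w)}"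
    using ratio_orbital_neighbour[OF assms(1), of "-1"] assms(2) minus_one_neq_one unfolding ranked_orbital_simps by auto
  then have "t = {Some m, Some (- m)}" by auto
  with \<open>m \<noteq> 0\<close> show ?thesis by blast
qed

lemma ranked_orbital_2_neighbour:
  assumes "card t = 2" "orbital base t = ranked_orbital 2"
  shows "\<exists>x j. x \<noteq> 0 \<and> j * j = -1 \<and> t = {Some x, Some (x * j)}"
proof -
  obtain m e w where w: "m \<noteq> 0" "w = \<iota> \<or> w = inverse \<iota>" "t = {Some m, Some (m * twist e w)}"
    using ratio_orbital_neighbour[OF assms(1) \<iota>_neq(1,2)] assms(2) unfolding ranked_orbital_simps by blast
  have "w * w = -1" using w(2) \<iota> by (auto simp: inverse_\<iota>)
  then have "twist e (w * w) = twist e (-1)" by (rule arg_cong)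
  then have "twist e w * twist e w = -1" by simp
  with w show ?thesis by blast
qed

text \<open>
  For two disjoint pairs harmonic to \<open>{\<infinity>, 0}\<close>, the four differences
  multiply to \<open>(y\<^sup>2 - x\<^sup>2)\<^sup>2\<close>.
\<close>
lemma ranked_orbital_bound_1:
  assumes "x \<noteq> 0" "y \<noteq> 0"
  shows "orbital {Some y, Some (- y)} {Some x, Some (- x)} \<in> {ranked_orbital 0, ranked_orbital 1, ranked_orbital 2}"
proof (cases "x = y \<or> x = - y")
  case True
  then have eq: "{Some x, Some (- x)} = {Some y, Some (- y)}" by auto
  have "y \<noteq> - y" using minus_neq_self[OF assms(2)] by auto
  then have "card {Some y, Some (- y)} = 2" by simp
  from M_to_zero_infinity[OF this] obtain g where g: "g \<in> M_perms" "g ` {Some y, Some (- y)} = base" by blast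
  have "orbital {Some y, Some (- y)} {Some y, Some (- y)} = ranked_orbital 0"
    using orbital_image[OF g(1), of "{Some y, Some (- y)}" "{Some y, Some (- y)}"]
    unfolding g(2) ranked_orbital_simps equal_orbital_def by (rule sym)
  then show ?thesis unfolding eq by blast
next
  case False
  have "distinct [y, - y, x, - x]" using False minus_neq_self[OF assms(1)] minus_neq_self[OF assms(2)] by auto
  moreover have "(y - x) * (y - - x) * (- y - x) * (- y - - x) = ((y - x) * (y + x))\<^sup>2"
    by (simp add: power2_eq_square algebra_simps)
  then have "is_square ((y - x) * (y - - x) * (- y - x) * (- y - - x))" by simp
  ultimately have "orbital {Some y, Some (- y)} {Some x, Some (- x)} \<in> {ranked_orbital 1, ranked_orbital 2}"
    by (rule orbital_square_cross_ratio)
  then show ?thesis by blast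
qed

text \<open>
  If the pairs are disjoint, the four differences multiply to
  \<open>x ^ 4 - y ^ 4\<close>. Fourth powers of nonzero elements are \<open>1\<close>
  or \<open>-1\<close>, and \<open>1 - (-1) = -1\<close> in characteristic 3, so the
  product is \<open>0\<close>, \<open>1\<close> or \<open>-1\<close>, which are squares.
\<close>
lemma ranked_orbital_bound_2:
  assumes "x \<noteq> 0" "y \<noteq> 0" "j * j = -1"
  shows "orbital {Some y, Some (y * j)} {Some x, Some (- x)} \<noteq> ranked_orbital 4"
proof
  assume *: "orbital {Some y, Some (y * j)} {Some x, Some (- x)} = ranked_orbital 4"
  have j: "j \<noteq> 1" using assms(3) minus_one_neq_one by auto
  have c: "card {Some y, Some (y * j)} = 2" "card {Some x, Some (- x)} = 2" "card base = 2" "card {Some 1, Some \<omega>} = 2"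
    using assms(1,2) minus_neq_self[OF assms(1)] j \<omega>_neq by auto
  have "card ({Some y, Some (y * j)} \<inter> {Some x, Some (- x)}) = card (base \<inter> {Some 1, Some \<omega>})"
    using orbital_eq_cards[OF c(1,2) c(3,4)] * unfolding ranked_orbital_simps ratio_orbital_def by simp
  also have "base \<inter> {Some 1, Some \<omega>} = {}" using \<omega>_neq by auto
  finally have "{Some y, Some (y * j)} \<inter> {Some x, Some (- x)} = {}" by simp
  then have d: "distinct [y, y * j, x, - x]" using minus_neq_self[OF assms(1)] assms(2) j by auto
  have "(y - x) * (y - - x) * (y * j - x) * (y * j - - x) = (y * y - x * x) * (y * y * (j * j) - x * x)"
    by (simp add: algebra_simps)
  also have "\<dots> = x ^ 4 - y ^ 4" unfolding assms(3) by (simp add: numeral_eq_Suc algebra_simps)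
  finally have prod: "(y - x) * (y - - x) * (y * j - x) * (y * j - - x) = x ^ 4 - y ^ 4" .
  have "x ^ 4 = 1 \<or> x ^ 4 = -1" "y ^ 4 = 1 \<or> y ^ 4 = -1" using power_half_order[OF assms(1)] power_half_order[OF assms(2)] by (simp_all add: half_order_eq_4)
  moreover have "(1::'a) - -1 = -1" "(-1::'a) - 1 = 1" using two_eq by simp_all
  ultimately have "x ^ 4 - y ^ 4 \<in> {0, 1, -1}" by auto
  then have "is_square (x ^ 4 - y ^ 4)" using is_square_minus_one by auto
  then have "orbital {Some y, Some (y * j)} {Some x, Some (- x)} \<in> {ranked_orbital 1, ranked_orbital 2}"
    by (intro orbital_square_cross_ratio d) (simp only: prod)
  with * show False using ranked_orbital_inj[of 4 1] ranked_orbital_inj[of 4 2] by auto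
qed

text \<open>
  The middle line of the two steps is moved to \<open>{\<infinity>, 0}\<close>. An index
  increase by more than one is possible only from \<open>i \<le> 2\<close>.
\<close>
lemma ranked_orbital_bound:
  assumes ij: "i \<le> 4" "j \<le> 4" and xy: "(x, y) \<in> ranked_orbital i" and yz: "(y, z) \<in> ranked_orbital 1" and xz: "(x, z) \<in> ranked_orbital j"
  shows "j \<le> Suc i"
proof -
  have mem: "ranked_orbital k \<in> M_scheme" if "k \<le> 4" for k unfolding M_scheme_9 using that by simp
  have lines: "\<exists>s t :: 'a option set. card s = 2 \<and> card t = 2 \<and> u = chord s \<and> v = chord t" if R: "R \<in> M_scheme" "(u, v) \<in> R" for R and u v :: "('a^3) set"
  proof -
    obtain a b where ab: "R = orbital a b" "card a = 2" "card b = 2" using R(1) unfolding M_scheme_eq by blast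
    then obtain g where "g \<in> M_perms" "u = chord (g ` a)" "v = chord (g ` b)" using R(2) by (auto simp: orbital_def)
    then show ?thesis using ab(2,3) card_image_M by (intro exI[of _ "g ` a"] exI[of _ "g ` b"]) simp
  qed
  obtain s u where s: "card s = 2" "x = chord s" and u: "card u = 2" "y = chord u" using lines[OF mem[OF ij(1)] xy] by blast
  obtain t where t: "card t = 2" "z = chord t" using lines[OF mem[OF ij(2)] xz] by blast
  obtain g where g: "g \<in> M_perms" "g ` u = base" using M_to_zero_infinity[OF u(1)] by blast
  define s' t' where "s' = g ` s" and "t' = g ` t"
  have c: "card s' = 2" "card t' = 2" "card base = 2" unfolding s'_def t'_def card_image_M[OF g(1)] using s t by simp_all
  have su: "ranked_orbital i = orbital s' base" and ut: "ranked_orbital 1 = orbital base t'" and st: "ranked_orbital j = orbital s' t'"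
    using orbital_of_member[OF mem[OF ij(1)], of s u] orbital_of_member[OF mem[of 1], of u t] orbital_of_member[OF mem[OF ij(2)], of s t]
      orbital_image[OF g(1), of s u] orbital_image[OF g(1), of u t] orbital_image[OF g(1), of s t]
      xy yz xz s t u unfolding s'_def t'_def g(2) by simp_all
  have bs: "orbital base s' = ranked_orbital i" unfolding su by (rule orbital_commute[OF c(3,1)])
  obtain v where v: "v \<noteq> 0" "t' = {Some v, Some (- v)}" using ranked_orbital_1_neighbour[OF c(2)] ut by metis
  consider "i = 0" | "i = 1" | "i = 2" | "i \<ge> 3" by linarith
  then show ?thesis
  proof cases
    case 1
    then have "(x, y) \<in> ranked_orbital 0" using xy by simp
    then have "x = y" unfolding ranked_orbital_simps equal_orbital_eq by blast
    then have "(chord u, chord t) \<in> ranked_orbital j" "(chord u, chord t) \<in> ranked_orbital 1" using xz yz t u by simp_all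
    then have "ranked_orbital j = ranked_orbital 1" using orbital_of_member[OF mem[OF ij(2)] _ u(1) t(1)] orbital_of_member[OF mem[of 1] _ u(1) t(1)] by simp
    then have "j = 1" using ranked_orbital_inj[OF ij(2), of 1] by simp
    then show ?thesis by simp
  next
    case 2
    then obtain y' where "y' \<noteq> 0" "s' = {Some y', Some (- y')}" using ranked_orbital_1_neighbour[OF c(1)] bs by blast
    then have "ranked_orbital j \<in> {ranked_orbital 0, ranked_orbital 1, ranked_orbital 2}" unfolding st v(2) using ranked_orbital_bound_1[OF v(1)] by simp
    then have "j = 0 \<or> j = 1 \<or> j = 2" using ranked_orbital_inj[OF ij(2), of 0] ranked_orbital_inj[OF ij(2), of 1] ranked_orbital_inj[OF ij(2), of 2] by auto
    then show ?thesis using 2 by auto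
  next
    case 3
    then obtain y' l where "y' \<noteq> 0" "l * l = -1" "s' = {Some y', Some (y' * l)}" using ranked_orbital_2_neighbour[OF c(1)] bs by blast
    then have "ranked_orbital j \<noteq> ranked_orbital 4" unfolding st v(2) using ranked_orbital_bound_2[OF v(1)] by simp
    then have "j \<noteq> 4" by auto
    then show ?thesis using 3 ij by simp
  next
    case 4
    then show ?thesis using ij by simp
  qed
qed

lemma orbital_base_opposite: "x \<noteq> 0 \<Longrightarrow> orbital base {Some x, Some (- x)} = ranked_orbital 1"
  using orbital_base_pair[of x "- x"] by (simp add: ranked_orbital_simps)

text \<open>
  By homogeneity one path through the middle line \<open>{\<infinity>, 0}\<close> suffices
  for each distance. The pairs at its ends are \<open>{1, -1}\<close> and
  \<open>{\<omega>, -\<omega>}\<close> for distance 2, \<open>{1, \<iota>}\<close> and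
  \<open>{1, -1}\<close> for distance 3, and \<open>{\<infinity>, 1}\<close> and
  \<open>{\<omega>, -\<omega>}\<close> for distance 4.
\<close>
lemma ranked_orbital_step:
  assumes "i < 4" shows "ranked_orbital (Suc i) \<subseteq> ranked_orbital i O ranked_orbital 1"
proof -
  have comp: "orbital s t \<subseteq> orbital base s O orbital base t" if "card s = 2" for s t
    using orbital_comp[of s t base] orbital_commute[of s base] that by simp
  have w: "orbital base {Some \<omega>, Some (- \<omega>)} = ranked_orbital 1" by (rule orbital_base_opposite[OF \<omega>_neq(1)])
  have one: "orbital base {Some 1, Some (-1)} = ranked_orbital 1" using orbital_base_opposite[of 1] by simp
  have n1: "(1::'a) \<noteq> -1" using minus_one_neq_one by simp
  consider "i = 0" | "i = 1" | "i = 2" | "i = 3" using assms by linarith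
  then show ?thesis
  proof cases
    case 1
    have "ranked_orbital 1 \<subseteq> equal_orbital O ranked_orbital 1"
      using comp[of base "{Some 1, Some (-1)}"] one by (simp add: equal_orbital_def)
    then show ?thesis using 1 by (simp add: ranked_orbital_simps)
  next
    case 2
    have "distinct [1, -1, w, - w]" if "w \<noteq> 0" "w \<noteq> 1" "w \<noteq> -1" for w :: 'a
      using n1 that minus_neq_self[OF that(1)] by (auto simp: eq_commute[of 1] minus_equation_iff)
    moreover have "\<omega> \<noteq> -1" using nonsquare_\<omega> is_square_minus_one by metis
    ultimately have d: "distinct [1, -1, \<omega>, - \<omega>]" using \<omega>_neq by blast
    \<comment> \<open>The cross ratio of \<open>1\<close>, \<open>-1\<close>, \<open>\<omega>\<close>, \<open>-\<omega>\<close>; it equals \<open>\<iota>\<close> since \<open>2 = -1\<close>.\<close>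
    define x where "x = ((- \<omega> - -1) * (\<omega> - 1)) / ((- \<omega> - 1) * (\<omega> - -1))"
    have "(- \<omega> - -1) * (\<omega> - 1) = 1" using \<iota> by simp
    moreover have "(- \<omega> - 1) * (\<omega> - -1) = - (2 + \<iota>) * (2 + \<iota>)" by (simp add: algebra_simps)
    moreover have "- (2 + \<iota>) * (2 + \<iota>) = - \<iota>" unfolding two_eq using \<iota> two_eq by (simp add: algebra_simps)
    ultimately have "x = \<iota>" unfolding x_def using inverse_\<iota> by (simp add: divide_inverse)
    then obtain e where e: "orbital {Some 1, Some (-1)} {Some \<omega>, Some (- \<omega>)} = ratio_orbital (twist e \<iota>)"
      using orbital_finite_pairs[OF d] unfolding x_def by auto
    have "twist e \<iota> = \<iota> \<or> twist e \<iota> = inverse \<iota>" by (simp add: twist_def \<sigma>_\<iota> inverse_\<iota>)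
    then have "orbital {Some 1, Some (-1)} {Some \<omega>, Some (- \<omega>)} = ranked_orbital 2"
      unfolding e ranked_orbital_simps using ratio_orbital_inverse[OF \<iota>_neq(1)] by metis
    then have "ranked_orbital 2 \<subseteq> ranked_orbital 1 O ranked_orbital 1"
      using comp[of "{Some 1, Some (-1)}" "{Some \<omega>, Some (- \<omega>)}"] w one n1 by simp
    then show ?thesis using 2 by (simp add: numeral_2_eq_2)
  next
    case 3
    \<comment> \<open>The two ends share the point \<open>1\<close>, so they are a meeting pair.\<close>
    have "orbital {Some 1, Some \<iota>} {Some 1, Some (-1)} = ranked_orbital 3"
      unfolding ranked_orbital_simps by (rule orbital_meeting) (use \<iota>_neq n1 in auto)
    moreover have "orbital base {Some 1, Some \<iota>} = ranked_orbital 2" by (simp add: ranked_orbital_simps ratio_orbital_def)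
    ultimately have "ranked_orbital 3 \<subseteq> ranked_orbital 2 O ranked_orbital 1"
      using comp[of "{Some 1, Some \<iota>}" "{Some 1, Some (-1)}"] one \<iota>_neq by simp
    then show ?thesis using 3 by (simp add: numeral_3_eq_3 numeral_2_eq_2)
  next
    case 4
    \<comment> \<open>The translation \<open>x \<mapsto> x - 1\<close> moves \<open>{\<infinity>, 1}\<close> to \<open>{\<infinity>, 0}\<close>.\<close>
    let ?g = "twisted_frac 1 (-1) 0 1"
    have g: "?g \<in> M_perms" by (intro twisted_frac_in_M) simp
    have val: "?g None = None" "?g (Some z) = Some (z - 1)" for z by (simp_all add: twisted_frac_apply twist_def)
    have e: "- \<omega> - 1 = 1 - \<iota>"
    proof -
      have "- \<omega> - 1 = - 2 - \<iota>" by simp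
      then show ?thesis by (simp add: two_eq)
    qed
    have "?g ` {None, Some 1} = base" "?g ` {Some \<omega>, Some (- \<omega>)} = {Some \<iota>, Some (1 - \<iota>)}"
      unfolding image_insert image_empty val e by simp_all
    then have "orbital {None, Some 1} {Some \<omega>, Some (- \<omega>)} = orbital base {Some \<iota>, Some (1 - \<iota>)}"
      using orbital_image[OF g, of "{None, Some 1}" "{Some \<omega>, Some (- \<omega>)}"] by simp
    also have "\<dots> = ratio_orbital (twist \<iota> ((1 - \<iota>) / \<iota>))" by (rule orbital_base_pair) (rule \<iota>_neq)
    also have "(1 - \<iota>) / \<iota> = - \<omega>" using inverse_\<iota> \<iota> by (simp add: divide_inverse algebra_simps)
    also have "ratio_orbital (twist \<iota> (- \<omega>)) = ratio_orbital \<omega>"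
      by (rule ratio_orbital_nonsquare) (simp only: is_square_twist_iff is_square_minus_iff nonsquare_\<omega> not_False_eq_True)
    finally have "orbital {None, Some 1} {Some \<omega>, Some (- \<omega>)} = ranked_orbital 4" by (simp only: ranked_orbital_simps)
    moreover have "orbital base {None, Some 1} = ranked_orbital 3" by (simp add: ranked_orbital_simps meeting_orbital_def)
    ultimately have "ranked_orbital 4 \<subseteq> ranked_orbital 3 O ranked_orbital 1"
      using comp[of "{None, Some 1}" "{Some \<omega>, Some (- \<omega>)}"] w by simp
    then show ?thesis using 4 by (simp add: numeral_eq_Suc)
  qed
qed

lemma P_polynomial_M_scheme_9: "P_polynomial_scheme (hyperbolic_lines :: ('a^3) set set) M_scheme"
proof (rule P_polynomial_schemeI)
  show "ranked_orbital 0 = Id_on hyperbolic_lines" unfolding ranked_orbital_simps by (rule equal_orbital_eq)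
qed (use association_scheme_M symmetric_M_scheme_9 num_classes_9 bij_ranked_orbital ranked_orbital_step ranked_orbital_bound in auto)

end

end

section \<open>The scheme of M(q) on hyperbolic lines\<close>

theorem theorem3p3:
  fixes p f :: nat
  assumes "prime p" and "odd p" and "f > 0"
    and "CARD('a::{field,finite}) = p ^ (2 * f)"
  shows "(CARD('a) > 9 \<longrightarrow>
            association_scheme (hyperbolic_lines :: ('a^3) set set) M_scheme \<and>
            \<not> symmetric_scheme (M_scheme :: ('a^3) set rel set) \<and>
            real (num_classes (hyperbolic_lines :: ('a^3) set set) M_scheme)
              = (3 * real CARD('a) + 5) / 8) \<and>
         (CARD('a) = 9 \<longrightarrow>
            association_scheme (hyperbolic_lines :: ('a^3) set set) M_scheme \<and>
            symmetric_scheme (M_scheme :: ('a^3) set rel set) \<and>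
            P_polynomial_scheme (hyperbolic_lines :: ('a^3) set set) M_scheme)"
proof -
  define r where "r = p ^ f"
  interpret square_order_field r "\<lambda>x::'a. x ^ r"
    unfolding r_def using assms by (rule square_order_field_Frobenius)
  have scheme: "association_scheme (hyperbolic_lines :: ('a^3) set set) M_scheme" by (rule association_scheme_M)
  have "real (8 * num_classes (hyperbolic_lines :: ('a^3) set set) M_scheme) = real (3 * CARD('a) + 5)"
    by (rule arg_cong[OF num_classes_M_scheme])
  then have classes: "real (num_classes (hyperbolic_lines :: ('a^3) set set) M_scheme) = (3 * real CARD('a) + 5) / 8"
    by simp
  have nonsym: "\<not> symmetric_scheme (M_scheme :: ('a^3) set rel set)" if "CARD('a) > 9"
  proof (rule not_symmetric_M_scheme)
    have "3\<^sup>2 < r\<^sup>2" using that by (simp add: card_field)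
    then have "r > 3" by (rule power_less_imp_less_base) simp
    with odd_r show "r \<ge> 5" by presburger
  qed
  have "symmetric_scheme (M_scheme :: ('a^3) set rel set) \<and>
    P_polynomial_scheme (hyperbolic_lines :: ('a^3) set set) M_scheme" if "CARD('a) = 9"
  proof -
    have "r\<^sup>2 = 3\<^sup>2" using that by (simp add: card_field)
    then have r: "r = 3" by (rule power2_eq_imp_eq) simp_all
    obtain \<iota> :: 'a where "-1 = \<iota>\<^sup>2" using is_square_minus_one by (rule is_nth_powerE)
    then have "\<iota> * \<iota> = -1" by (simp add: power2_eq_square)
    with r show ?thesis using symmetric_M_scheme_9 P_polynomial_M_scheme_9 by blast
  qed
  with scheme classes nonsym show ?thesis by blast
qed

end
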